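(* Let $a\in\mathbb Z$ and let $q$ be an arbitrary number such that $|q|<1$. Put $$k_{11}=\frac{8q^{1/2}\phi(-q)^{12}}{1+\sqrt{1+64q\,\phi(-q)^{24}}},\qquad k_{12}=\sqrt{1-k_{11}^2},\qquad k_{21}=\frac{2-k_{11}^2-2k_{12}}{k_{11}^2},\qquad k_{22}=\sqrt{1-k_{21}^2}.$$ Then $$\frac{1}{1-}\,\frac{q^{2a+2}}{1+}\,\frac{q^{2a+2}(1-q^2)}{1-}\,\frac{q^{2a+6}}{1+}\,\frac{q^{2a+4}(1-q^4)}{1-}\cdots+\frac{q^{-2a}}{1-}\,\frac{q^{-2a+2}}{1+}\,\frac{q^{-2a+2}(1-q^2)}{1-}\,\frac{q^{-2a+6}}{1+}\,\frac{q^{-2a+4}(1-q^4)}{1-}\cdots$$ $$=2^{5/6}q^{-\frac14(2a+1)^2}\frac{(k_{11}k_{12}k_{21})^{1/6}}{k_{22}^{1/3}}\sqrt{\frac{K(k_{11})}{\pi}}.$$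
   Context: Here $\phi(-q)=(-q;q)_\infty=\prod_{n=1}^\infty(1+q^n)$ and $K(x)=\int_0^{\pi/2}\frac{dt}{\sqrt{1-x^2\sin^2 t}}$ is the complete elliptic integral of the first kind. When $q=e^{-\pi\sqrt r}$ with $r>0$, the number $k_{11}$ above is the solution $k$ of $K(\sqrt{1-k^2})/K(k)=\sqrt r$. The two continued fractions are $\mathcal M(q^{2a},q^2)$ and $q^{-2a}\mathcal M(q^{-2a},q^2)$, where $$\mathcal M(c,Q)=\frac{1}{1-}\,\frac{cQ}{1+}\,\frac{c(Q-Q^2)}{1-}\,\frac{cQ^3}{1+}\,\frac{c(Q^2-Q^4)}{1-}\cdots,$$ that is, all partial denominators equal $1$, the first partial numerator is $1$, and for $j=1,2,3,\dots$ the following partial numerators are, in alternation, $-cQ^{2j-1}$ and $+c(Q^j-Q^{2j})$.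
   Formalization: q = 0 is excluded (right side undefined); for q not in (0,1) the square roots, fractional powers and K are taken by analytic continuation in log q from 0<q<1, since with principal branches the identity fails, e.g. for a = 0 and small negative q. *)

theory Defs
  imports "HOL-Complex_Analysis.Complex_Analysis"
begin

text \<open>
  The continued fraction \<open>p 0 / (b 0 + p 1 / (b 1 + p 2 / (b 2 + ...)))\<close>: its \<open>n\<close>-th convergent is
  \<open>cf_num p b n / cf_den p b n\<close>.  Finitely many convergents may have denominator zero.
\<close>

fun cf_num :: "(nat \<Rightarrow> complex) \<Rightarrow> (nat \<Rightarrow> complex) \<Rightarrow> nat \<Rightarrow> complex" where
  "cf_num p b 0 = 0"
| "cf_num p b (Suc 0) = p 0"
| "cf_num p b (Suc (Suc n)) = b (Suc n) * cf_num p b (Suc n) + p (Suc n) * cf_num p b n"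

fun cf_den :: "(nat \<Rightarrow> complex) \<Rightarrow> (nat \<Rightarrow> complex) \<Rightarrow> nat \<Rightarrow> complex" where
  "cf_den p b 0 = 1"
| "cf_den p b (Suc 0) = b 0"
| "cf_den p b (Suc (Suc n)) = b (Suc n) * cf_den p b (Suc n) + p (Suc n) * cf_den p b n"

definition cf_has_value :: "(nat \<Rightarrow> complex) \<Rightarrow> (nat \<Rightarrow> complex) \<Rightarrow> complex \<Rightarrow> bool" where
  "cf_has_value p b v \<longleftrightarrow>
     (\<forall>\<^sub>F n in sequentially. cf_den p b n \<noteq> 0) \<and>
     (\<lambda>n. cf_num p b n / cf_den p b n) \<longlonglongrightarrow> v"

text \<open>
  With the first partial numerator at index \<open>0\<close>, the numerators \<open>- c Q^(2j-1)\<close> and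
  \<open>c (Q^j - Q^(2j))\<close> have the indices \<open>2j-1\<close> and \<open>2j\<close>.
\<close>

definition M_numerator :: "complex \<Rightarrow> complex \<Rightarrow> nat \<Rightarrow> complex" where
  "M_numerator c Q n =
     (if n = 0 then 1
      else if odd n then - c * Q ^ n
      else c * (Q ^ (n div 2) - Q ^ n))"

definition M_has_value :: "complex \<Rightarrow> complex \<Rightarrow> complex \<Rightarrow> bool" where
  "M_has_value c Q v \<longleftrightarrow> cf_has_value (M_numerator c Q) (\<lambda>_. 1) v"

text \<open>\<open>phi_neg q\<close> stands for \<open>\<phi>(-q)\<close>.\<close>

definition phi_neg :: "complex \<Rightarrow> complex" where
  "phi_neg q = (\<Prod>n. 1 + q ^ Suc n)"

definition ellK :: "complex \<Rightarrow> complex" where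
  "ellK x = integral {0..pi/2} (\<lambda>t. 1 / csqrt (1 - x\<^sup>2 * (of_real (sin t))\<^sup>2))"

text \<open>
  The moduli with principal roots.  They are only used for \<open>0 < q < 1\<close>, where all radicands are
  positive reals.
\<close>

definition k11 :: "complex \<Rightarrow> complex" where
  "k11 q = 8 * csqrt q * phi_neg q ^ 12 / (1 + csqrt (1 + 64 * q * phi_neg q ^ 24))"

definition k12 :: "complex \<Rightarrow> complex" where
  "k12 q = csqrt (1 - (k11 q)\<^sup>2)"

definition k21 :: "complex \<Rightarrow> complex" where
  "k21 q = (2 - (k11 q)\<^sup>2 - 2 * k12 q) / (k11 q)\<^sup>2"

definition k22 :: "complex \<Rightarrow> complex" where
  "k22 q = csqrt (1 - (k21 q)\<^sup>2)"

text \<open>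
  For complex \<open>q\<close> the fractional powers, the square roots and \<open>K\<close> are multivalued; with principal
  branches the identity fails, e.g. for small negative \<open>q\<close>.  They are understood by analytic
  continuation from the real interval \<open>0 < q < 1\<close>, in the variable \<open>w = log q\<close>, which ranges over
  the left half-plane.  The continuation is unique if it exists.
\<close>

definition log_continuation :: "(complex \<Rightarrow> complex) \<Rightarrow> (complex \<Rightarrow> complex) \<Rightarrow> bool" where
  "log_continuation F f \<longleftrightarrow>
     F holomorphic_on {w. Re w < 0} \<and>
     (\<forall>x::real. x < 0 \<longrightarrow> F (of_real x) = f (exp (of_real x)))"

end

theory Submission
  imports Defs
begin

text \<open>
  The continued fraction \<open>M(c, q^2)\<close> has the value \<open>sum c^n q^(n (n + 1))\<close>, summed over \<open>n \<ge> 0\<close>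
  (\<open>M_has_value_partial_theta\<close>): the weighted series \<open>M_tail\<close> solve its recurrence and tend to one,
  so they are its tails.  For \<open>c = q^(2 a)\<close> and \<open>c = q^(-2 a)\<close> the two series are, up to a power of
  \<open>q\<close>, the sums of \<open>q^((n + 1/2)^2)\<close> over \<open>n \<ge> a\<close> and over \<open>n < a\<close>.  Together they give the full
  theta constant, so the left-hand side is \<open>q^(- (2 a + 1)^2 / 4) theta2(q)\<close> (\<open>theta_partial_sums\<close>).

  The right-hand side is evaluated by classical theta function theory.  By the triple product
  \<open>k11 = theta2^2 / theta3^2\<close> for the nome \<open>q\<close> (\<open>theta_phi_neg\<close>), and by the duplication formulas,
  all instances of \<open>theta_mult\<close>, the modulus \<open>k21\<close> is the same quotient for the nome \<open>q^2\<close>.  The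
  formulas also give \<open>k11 k12 k21 / k22^2 = (theta2 / theta3)^6 / 4\<close> (\<open>moduli_identities\<close>).  Finally
  \<open>K(k11) = (pi / 2) theta3^2\<close> (\<open>ellK_theta\<close>), because doubling the exponent of the nome is a step
  of the arithmetic-geometric mean, under which Gauss' integral is invariant
  (\<open>gauss_integral_landen\<close>).  Hence the roots combine to \<open>2^(-5/6) theta2\<close>.

  In the variable \<open>w = log q\<close> the theta constants are holomorphic without zeros on the left half-plane.
  All moduli and roots thus have continuations there, and the identity proved for real \<open>w\<close> extends by
  the identity theorem (\<open>moduli_continuations\<close>).
\<close>

section \<open>Infinite products and Gaussian binomial coefficients\<close>

definition qprod :: "complex \<Rightarrow> complex \<Rightarrow> complex" where
  "qprod x Q = (\<Prod>n. 1 + x * Q ^ n)"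

lemma qprod_convergent:
  fixes x Q :: complex
  assumes "norm Q < 1"
  shows "convergent_prod (\<lambda>n. 1 + x * Q ^ n)"
proof (rule abs_convergent_prod_imp_convergent_prod)
  show "abs_convergent_prod (\<lambda>n. 1 + x * Q ^ n)"
    unfolding abs_convergent_prod_conv_summable
    using assms by (simp add: norm_mult norm_power summable_mult summable_geometric)
qed

lemma qprod_LIMSEQ:
  assumes "norm Q < 1"
  shows "(\<lambda>n. \<Prod>j<n. 1 + x * Q ^ j) \<longlonglongrightarrow> qprod x Q"
  unfolding qprod_def
  using convergent_prod_LIMSEQ[OF qprod_convergent[OF assms]]
  by (simp add: LIMSEQ_lessThan_iff_atMost)

lemma qprod_nonzero:
  assumes "norm Q < 1" "norm x < 1"
  shows "qprod x Q \<noteq> 0"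
  unfolding qprod_def
proof (rule prodinf_nonzero[OF qprod_convergent[OF assms(1)]])
  fix n
  have "norm (x * Q ^ n) \<le> norm x"
    using assms by (simp add: norm_mult norm_power mult_left_le power_le_one)
  with assms have "norm (x * Q ^ n) < 1" by linarith
  then show "1 + x * Q ^ n \<noteq> 0"
    by (metis add_eq_0_iff norm_minus_cancel norm_one less_irrefl)
qed

lemma qprod_step:
  assumes "norm Q < 1"
  shows "qprod x Q = (1 + x) * qprod (x * Q) Q"
proof (rule LIMSEQ_unique)
  show "(\<lambda>n. \<Prod>j<Suc n. 1 + x * Q ^ j) \<longlonglongrightarrow> qprod x Q"
    using qprod_LIMSEQ[OF assms, of x] by (rule LIMSEQ_Suc)
  have "(\<lambda>n. (1 + x) * (\<Prod>j<n. 1 + x * Q * Q ^ j)) \<longlonglongrightarrow> (1 + x) * qprod (x * Q) Q"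
    by (intro tendsto_intros qprod_LIMSEQ assms)
  then show "(\<lambda>n. \<Prod>j<Suc n. 1 + x * Q ^ j) \<longlonglongrightarrow> (1 + x) * qprod (x * Q) Q"
    by (simp only: prod.lessThan_Suc_shift) (simp add: mult_ac)
qed

text \<open>
  Even and odd indices: this is how infinite products to the base \<open>q\<close> are turned into the products
  to the base \<open>q^2\<close> that occur in the theta functions.
\<close>
lemma qprod_split:
  assumes "norm Q < 1"
  shows "qprod x Q = qprod x (Q\<^sup>2) * qprod (x * Q) (Q\<^sup>2)"
proof (rule LIMSEQ_unique)
  have Q2: "norm (Q\<^sup>2) < 1"
    using assms by (simp add: norm_power power_less_one_iff abs_square_less_1)
  have "(\<lambda>n. \<Prod>j<2 * n. 1 + x * Q ^ j) \<longlonglongrightarrow> qprod x Q"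
    using LIMSEQ_subseq_LIMSEQ[OF qprod_LIMSEQ[OF assms, of x], of "\<lambda>n. 2 * n"]
    by (simp add: strict_mono_def o_def)
  also have "(\<lambda>n. \<Prod>j<2 * n. 1 + x * Q ^ j) =
    (\<lambda>n. (\<Prod>j<n. 1 + x * (Q\<^sup>2) ^ j) * (\<Prod>j<n. 1 + x * Q * (Q\<^sup>2) ^ j))" (is "?l = ?r")
  proof
    show "?l n = ?r n" for n
    proof (induction n)
      case (Suc n)
      have "2 * Suc n = Suc (Suc (2 * n))" by simp
      then show ?case
        by (simp only: prod.lessThan_Suc Suc.IH) (simp add: power_mult power2_eq_square power_mult_distrib mult_ac)
    qed simp
  qed
  finally show "?r \<longlonglongrightarrow> qprod x Q" .
  show "?r \<longlonglongrightarrow> qprod x (Q\<^sup>2) * qprod (x * Q) (Q\<^sup>2)"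
    by (intro tendsto_intros qprod_LIMSEQ Q2)
qed

lemma qprod_mult_minus:
  assumes "norm Q < 1"
  shows "qprod x Q * qprod (- x) Q = qprod (- (x\<^sup>2)) (Q\<^sup>2)"
proof (rule LIMSEQ_unique)
  have Q2: "norm (Q\<^sup>2) < 1"
    using assms by (simp add: norm_power power_less_one_iff abs_square_less_1)
  have "(\<lambda>n. (\<Prod>j<n. 1 + x * Q ^ j) * (\<Prod>j<n. 1 + (- x) * Q ^ j)) \<longlonglongrightarrow> qprod x Q * qprod (- x) Q"
    by (intro tendsto_mult qprod_LIMSEQ assms)
  also have "(\<lambda>n. (\<Prod>j<n. 1 + x * Q ^ j) * (\<Prod>j<n. 1 + (- x) * Q ^ j)) =
      (\<lambda>n. \<Prod>j<n. 1 + - (x\<^sup>2) * (Q\<^sup>2) ^ j)"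
    by (simp add: prod.distrib[symmetric] algebra_simps power2_eq_square power_mult_distrib)
  finally show "(\<lambda>n. \<Prod>j<n. 1 + - (x\<^sup>2) * (Q\<^sup>2) ^ j) \<longlonglongrightarrow> qprod x Q * qprod (- x) Q" .
  show "(\<lambda>n. \<Prod>j<n. 1 + - (x\<^sup>2) * (Q\<^sup>2) ^ j) \<longlonglongrightarrow> qprod (- (x\<^sup>2)) (Q\<^sup>2)"
    by (rule qprod_LIMSEQ[OF Q2])
qed

lemma qprod_real_pos:
  assumes "0 \<le> Q" "Q < 1" "\<bar>x\<bar> < 1"
  obtains r :: real where "r > 0" "qprod (of_real x) (of_real Q) = of_real r"
proof -
  have Q: "norm (of_real Q :: complex) < 1" using assms by simp
  have "qprod (of_real x) (of_real Q) \<in> \<real>\<^sub>\<ge>\<^sub>0"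
  proof (rule Lim_in_closed_set[OF closed_nonneg_Reals_complex _ _ qprod_LIMSEQ[OF Q]])
    have "(\<Prod>j<n. 1 + complex_of_real x * complex_of_real Q ^ j) = of_real (\<Prod>j<n. 1 + x * Q ^ j)" for n
      by simp
    moreover have "(\<Prod>j<n. 1 + x * Q ^ j) \<ge> 0" for n
    proof (rule prod_nonneg)
      fix j
      have "\<bar>x * Q ^ j\<bar> \<le> \<bar>x\<bar> * 1"
        unfolding abs_mult using assms by (intro mult_left_mono) (auto simp: power_le_one)
      then show "0 \<le> 1 + x * Q ^ j" using assms by linarith
    qed
    ultimately show "\<forall>\<^sub>F n in sequentially. (\<Prod>j<n. 1 + complex_of_real x * complex_of_real Q ^ j) \<in> \<real>\<^sub>\<ge>\<^sub>0"
      by (simp add: nonneg_Reals_of_real_iff del: of_real_prod of_real_mult of_real_add)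
  qed simp
  then obtain r where r: "r \<ge> 0" "qprod (of_real x) (of_real Q) = of_real r"
    by (auto simp: nonneg_Reals_def)
  moreover have "qprod (of_real x) (of_real Q) \<noteq> 0"
    using assms Q by (intro qprod_nonzero) auto
  ultimately show ?thesis using that by (metis less_eq_real_def of_real_0)
qed

text \<open>
  Gaussian binomial coefficients as quotients of \<open>(Q; Q)_n\<close>.  They are set to zero above the
  diagonal, so that the Pascal rules and the tail series of the continued fraction have no boundary
  cases.
\<close>
definition qfact :: "complex \<Rightarrow> nat \<Rightarrow> complex" where
  "qfact Q n = (\<Prod>j<n. 1 - Q ^ Suc j)"

definition qbin :: "complex \<Rightarrow> nat \<Rightarrow> nat \<Rightarrow> complex" where
  "qbin Q n k = (if k \<le> n then qfact Q n / (qfact Q k * qfact Q (n - k)) else 0)"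

lemma qfact_0 [simp]: "qfact Q 0 = 1"
  by (simp add: qfact_def)

lemma qfact_Suc: "qfact Q (Suc n) = qfact Q n * (1 - Q ^ Suc n)"
  by (simp add: qfact_def)

lemma one_minus_power_nonzero:
  assumes "norm Q < 1"
  shows "1 - Q ^ Suc n \<noteq> (0 :: complex)"
proof -
  have "norm (Q ^ Suc n) < 1"
    using assms by (simp add: norm_power norm_mult power_le_one mult_le_one le_less_trans[OF mult_left_le])
  then show ?thesis by (metis norm_one less_irrefl right_minus_eq)
qed

lemma qfact_nonzero: "norm Q < 1 \<Longrightarrow> qfact Q n \<noteq> 0"
  using one_minus_power_nonzero by (simp add: qfact_def)

lemma qfact_LIMSEQ:
  assumes "norm Q < 1"
  shows "qfact Q \<longlonglongrightarrow> qprod (- Q) Q"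
  using qprod_LIMSEQ[OF assms, of "- Q"] by (simp add: qfact_def[abs_def])

lemma qbin_0 [simp]: "norm Q < 1 \<Longrightarrow> qbin Q n 0 = 1"
  by (simp add: qbin_def qfact_nonzero)

lemma qbin_gt [simp]: "n < k \<Longrightarrow> qbin Q n k = 0"
  by (simp add: qbin_def)

lemma qbin_self [simp]: "norm Q < 1 \<Longrightarrow> qbin Q n n = 1"
  by (simp add: qbin_def qfact_nonzero)

lemma qbin_Suc_Suc:
  assumes "norm Q < 1"
  shows "qbin Q (Suc n) (Suc k) = qbin Q n k + Q ^ Suc k * qbin Q n (Suc k)"
proof -
  consider "n < k" | "n = k" | d where "n = Suc (k + d)"
    by (metis less_imp_Suc_add linorder_neqE_nat)
  then show ?thesis
  proof cases
    case 3
    define s t where "s = 1 - Q ^ Suc k" and "t = 1 - Q ^ Suc d"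
    have nz: "qfact Q n \<noteq> 0" "qfact Q k \<noteq> 0" "qfact Q d \<noteq> 0" "s \<noteq> 0" "t \<noteq> 0"
      unfolding s_def t_def using assms qfact_nonzero one_minus_power_nonzero by blast+
    have st: "1 - Q ^ Suc n = s + t - s * t"
      using 3 by (simp add: s_def t_def algebra_simps flip: power_add)
    have diff: "Suc n - Suc k = Suc d" "n - k = Suc d" "n - Suc k = d" "Suc k \<le> n" "k \<le> n"
      using 3 by auto
    have "qbin Q (Suc n) (Suc k) = qfact Q n * (s + t - s * t) / (qfact Q k * s * (qfact Q d * t))"
      "qbin Q n k = qfact Q n / (qfact Q k * (qfact Q d * t))"
      "qbin Q n (Suc k) = qfact Q n / (qfact Q k * s * qfact Q d)"
      using diff by (simp_all only: qbin_def qfact_Suc st s_def[symmetric] t_def[symmetric] Suc_le_mono if_True)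
    moreover have "Q ^ Suc k = 1 - s" by (simp add: s_def)
    ultimately show ?thesis
      using nz by (simp only:) (simp add: field_simps)
  qed (use assms in auto)
qed

lemma qbin_symmetric: "k \<le> n \<Longrightarrow> qbin Q n (n - k) = qbin Q n k"
  by (simp add: qbin_def mult.commute)

lemma qbin_Suc_Suc':
  assumes "norm Q < 1"
  shows "qbin Q (Suc (n + k)) (Suc k) = qbin Q (n + k) (Suc k) + Q ^ n * qbin Q (n + k) k"
proof (cases n)
  case (Suc n')
  have "qbin Q (Suc (n + k)) (Suc k) = qbin Q (Suc (n + k)) (Suc n')"
    using qbin_symmetric[of "Suc k" "Suc (n + k)" Q] Suc by simp
  also have "\<dots> = qbin Q (n + k) n' + Q ^ n * qbin Q (n + k) n"
    using Suc qbin_Suc_Suc[OF assms, of "n + k" n'] by simp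
  also have "qbin Q (n + k) n' = qbin Q (n + k) (Suc k)"
    using qbin_symmetric[of "Suc k" "n + k" Q] Suc by simp
  also have "qbin Q (n + k) n = qbin Q (n + k) k"
    using qbin_symmetric[of k "n + k" Q] by simp
  finally show ?thesis .
qed (use assms in simp)

lemma qbin_absorb:
  assumes "norm Q < 1"
  shows "(1 - Q ^ Suc k) * qbin Q (n + Suc k) (Suc k) = (1 - Q ^ Suc n) * qbin Q (n + Suc k) k"
proof -
  have "n + Suc k - k = Suc n" by simp
  moreover have "qfact Q n \<noteq> 0" "qfact Q k \<noteq> 0" "1 - Q ^ Suc k \<noteq> 0" "1 - Q ^ Suc n \<noteq> 0"
    using assms qfact_nonzero one_minus_power_nonzero by blast+
  ultimately show ?thesis
    by (simp add: qbin_def qfact_Suc[of Q n] qfact_Suc[of Q k] divide_simps del: power_Suc)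
qed

text \<open>
  One bound serves for all \<open>n\<close> and \<open>k\<close>, because \<open>(Q; Q)_n\<close> converges to a nonzero limit.  It
  supplies the majorants both for the continued fraction and for the triple product.
\<close>
lemma qbin_bounded:
  assumes "norm Q < 1"
  obtains B where "B > 0" "\<And>n k. norm (qbin Q n k) \<le> B"
proof -
  have "Bseq (qfact Q)"
    using qfact_LIMSEQ[OF assms] by (intro convergent_imp_Bseq convergentI)
  then obtain U where U: "U > 0" "\<And>n. norm (qfact Q n) \<le> U"
    by (auto elim!: BseqE)
  have "(\<lambda>n. inverse (qfact Q n)) \<longlonglongrightarrow> inverse (qprod (- Q) Q)"
    using assms by (intro tendsto_inverse qfact_LIMSEQ qprod_nonzero) auto
  then have "Bseq (\<lambda>n. inverse (qfact Q n))"
    by (intro convergent_imp_Bseq convergentI)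
  then obtain V where V: "V > 0" "\<And>n. norm (inverse (qfact Q n)) \<le> V"
    by (auto elim!: BseqE)
  show ?thesis
  proof
    show "U * (V * V) > 0" using U V by simp
    fix n k
    have "norm (qfact Q n * (inverse (qfact Q k) * inverse (qfact Q (n - k)))) \<le> U * (V * V)"
      unfolding norm_mult using U V by (intro mult_mono mult_nonneg_nonneg) (auto simp: less_imp_le)
    then show "norm (qbin Q n k) \<le> U * (V * V)"
      using U V by (auto simp: qbin_def divide_inverse)
  qed
qed

text \<open>
  Cauchy's binomial theorem, to the base \<open>q^2\<close> in order that the exponent \<open>k (k - 1)\<close> needs no
  division by two.
\<close>
lemma qbin_theorem:
  assumes "norm (q\<^sup>2) < 1"
  shows "(\<Prod>j<N. 1 + x * (q\<^sup>2) ^ j) = (\<Sum>k\<le>N. qbin (q\<^sup>2) N k * q ^ (k * (k - 1)) * x ^ k)"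
proof (induction N arbitrary: x)
  case 0
  then show ?case using assms by simp
next
  case (Suc N)
  let ?b = "qbin (q\<^sup>2)"
  define g where "g k = ?b N k * q ^ (k * (k - 1)) * (x * q\<^sup>2) ^ k" for k
  have g_Suc: "?b (Suc N) (Suc k) * q ^ (Suc k * (Suc k - 1)) * x ^ Suc k = g (Suc k) + x * g k" for k
  proof -
    have e: "q ^ (k * (k - 1)) * (x * q\<^sup>2) ^ k = q ^ (Suc k * k) * x ^ k"
    proof -
      have "k * (k - 1) + 2 * k = Suc k * k" by (cases k) (auto simp: algebra_simps)
      then have "q ^ (k * (k - 1)) * q ^ (2 * k) = q ^ (Suc k * k)"
        by (simp only: flip: power_add)
      then show ?thesis by (simp add: power_mult_distrib power_mult[of q 2])
    qed
    show ?thesis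
      unfolding g_def mult.assoc e qbin_Suc_Suc[OF assms]
      by (simp add: algebra_simps power_mult_distrib)
  qed
  have "(\<Prod>j<Suc N. 1 + x * (q\<^sup>2) ^ j) = (1 + x) * (\<Prod>j<N. 1 + (x * q\<^sup>2) * (q\<^sup>2) ^ j)"
    by (simp only: prod.lessThan_Suc_shift) (simp add: mult_ac)
  also have "\<dots> = (1 + x) * (\<Sum>k\<le>N. g k)"
    unfolding Suc.IH g_def ..
  also have "\<dots> = (\<Sum>k\<le>Suc N. g k) + x * (\<Sum>k\<le>N. g k)"
    by (simp add: g_def algebra_simps)
  also have "(\<Sum>k\<le>Suc N. g k) = g 0 + (\<Sum>k\<le>N. g (Suc k))"
    by (rule sum.atMost_Suc_shift)
  also have "g 0 + (\<Sum>k\<le>N. g (Suc k)) + x * (\<Sum>k\<le>N. g k) = g 0 + (\<Sum>k\<le>N. g (Suc k) + x * g k)"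
    by (simp add: sum.distrib sum_distrib_left)
  also have "\<dots> = (\<Sum>k\<le>Suc N. ?b (Suc N) k * q ^ (k * (k - 1)) * x ^ k)"
    unfolding sum.atMost_Suc_shift g_Suc using assms by (simp add: g_def)
  finally show ?case .
qed

section \<open>The value of the continued fraction\<close>

text \<open>
  Numerators and denominators of the convergents satisfy one recurrence forwards, the tails \<open>f\<close>
  satisfy it backwards; the bilinear combination of the two is therefore constant in \<open>n\<close>.
\<close>
lemma cf_recurrence_invariant:
  fixes f p X :: "nat \<Rightarrow> complex"
  assumes X: "\<And>n. X (Suc (Suc n)) = X (Suc n) + p (Suc n) * X n"
    and f: "\<And>n. f n = f (Suc n) + p (Suc n) * f (Suc (Suc n))"
  shows "X (Suc n) * f (Suc n) + p (Suc n) * X n * f (Suc (Suc n)) =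
         X (Suc 0) * f (Suc 0) + p (Suc 0) * X 0 * f (Suc (Suc 0))"
proof (induction n)
  case (Suc n)
  have "X (Suc (Suc n)) * f (Suc (Suc n)) + p (Suc (Suc n)) * X (Suc n) * f (Suc (Suc (Suc n))) =
      X (Suc n) * (f (Suc (Suc n)) + p (Suc (Suc n)) * f (Suc (Suc (Suc n)))) + p (Suc n) * X n * f (Suc (Suc n))"
    by (simp add: X algebra_simps)
  also have "\<dots> = X (Suc n) * f (Suc n) + p (Suc n) * X n * f (Suc (Suc n))"
    by (simp only: f[of "Suc n", symmetric])
  finally show ?case using Suc by simp
qed simp

lemma cf_recurrence_bounded:
  fixes p X :: "nat \<Rightarrow> complex"
  assumes X: "\<And>n. X (Suc (Suc n)) = X (Suc n) + p (Suc n) * X n"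
    and p: "summable (\<lambda>n. norm (p n))"
  shows "Bseq X"
proof -
  define C where "C = max (norm (X 0)) (norm (X (Suc 0)))"
  define P where "P n = (\<Prod>j<n. 1 + norm (p j))" for n
  have P1: "P n \<ge> 1" and P_mono: "P n \<le> P (Suc n)" for n
    unfolding P_def by (auto intro!: prod_ge_1 mult_nonneg_nonneg prod_nonneg simp: algebra_simps)
  have C: "C \<ge> 0" "norm (X 0) \<le> C" "norm (X (Suc 0)) \<le> C"
    by (auto simp: C_def le_max_iff_disj)
  have bound: "norm (X n) \<le> C * P n \<and> norm (X (Suc n)) \<le> C * P (Suc n)" for n
  proof (induction n)
    case 0
    have "C * 1 \<le> C * P 0" "C * 1 \<le> C * P (Suc 0)"
      using P1 C by (intro mult_left_mono; simp)+
    then show ?case using C by linarith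
  next
    case (Suc n)
    have "norm (X n) \<le> C * P (Suc n)"
      using Suc P_mono[of n] C by (meson mult_left_mono order_trans)
    then have "norm (p (Suc n)) * norm (X n) \<le> norm (p (Suc n)) * (C * P (Suc n))"
      by (intro mult_left_mono) auto
    moreover have "norm (X (Suc (Suc n))) \<le> norm (X (Suc n)) + norm (p (Suc n)) * norm (X n)"
      unfolding X by (rule order_trans[OF norm_triangle_ineq]) (simp add: norm_mult)
    ultimately have "norm (X (Suc (Suc n))) \<le> C * P (Suc n) + norm (p (Suc n)) * (C * P (Suc n))"
      using Suc by linarith
    also have "\<dots> = C * P (Suc (Suc n))"
      by (simp add: P_def algebra_simps)
    finally show ?case using Suc by blast
  qed
  have "abs_convergent_prod (\<lambda>n. 1 + norm (p n))"
    unfolding abs_convergent_prod_conv_summable using p by simp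
  then have "convergent_prod (\<lambda>n. 1 + norm (p n))"
    by (rule abs_convergent_prod_imp_convergent_prod)
  then have "P \<longlonglongrightarrow> (\<Prod>n. 1 + norm (p n))"
    unfolding P_def LIMSEQ_lessThan_iff_atMost by (rule convergent_prod_LIMSEQ)
  then have "Bseq P" by (intro convergent_imp_Bseq convergentI)
  then obtain B where B: "\<And>n. norm (P n) \<le> B"
    by (metis BseqE)
  have "norm (X n) \<le> C * B" for n
  proof -
    have "norm (X n) \<le> C * P n" using bound by blast
    also have "\<dots> \<le> C * B" using B[of n] C(1) by (intro mult_left_mono) auto
    finally show ?thesis .
  qed
  then show ?thesis by (intro BseqI') auto
qed

text \<open>
  A form of Pincherle's theorem.  Since \<open>p\<close> tends to zero and \<open>f\<close> to one, the invariant above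
  forces numerators and denominators to converge separately, to \<open>p 0 * f 1\<close> and \<open>f 0\<close>.  In
  particular the denominators are eventually nonzero as soon as \<open>f 0 \<noteq> 0\<close>.
\<close>
lemma cf_has_value_tails:
  fixes f p :: "nat \<Rightarrow> complex"
  assumes p: "summable (\<lambda>n. norm (p n))"
    and f: "\<And>n. f n = f (Suc n) + p (Suc n) * f (Suc (Suc n))"
    and lim: "f \<longlonglongrightarrow> 1" and "f 0 \<noteq> 0"
  shows "cf_has_value p (\<lambda>_. 1) (p 0 * f 1 / f 0)"
proof -
  have X_lim: "(\<lambda>n. X (Suc n)) \<longlonglongrightarrow> X (Suc 0) * f (Suc 0) + p (Suc 0) * X 0 * f (Suc (Suc 0))" (is "_ \<longlonglongrightarrow> ?L")
    if X: "\<And>n. X (Suc (Suc n)) = X (Suc n) + p (Suc n) * X n" for X :: "nat \<Rightarrow> complex"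
  proof -
    have fS: "(\<lambda>n. f (Suc n)) \<longlonglongrightarrow> 1" "(\<lambda>n. f (Suc (Suc n))) \<longlonglongrightarrow> 1"
      using LIMSEQ_Suc[OF lim] LIMSEQ_Suc[OF LIMSEQ_Suc[OF lim]] by auto
    have "p \<longlonglongrightarrow> 0"
      using summable_LIMSEQ_zero[OF p] by (simp add: tendsto_norm_zero_iff)
    then have "Zfun (\<lambda>n. p (Suc n)) sequentially"
      using LIMSEQ_Suc[of p 0] by (simp add: tendsto_Zfun_iff)
    moreover have "Bfun X sequentially"
      using cf_recurrence_bounded[OF X p] by simp
    ultimately have "Zfun (\<lambda>n. p (Suc n) * X n) sequentially"
      by (rule bounded_bilinear.Zfun_prod_Bfun[OF bounded_bilinear_mult])
    then have "(\<lambda>n. p (Suc n) * X n) \<longlonglongrightarrow> 0"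
      by (simp add: tendsto_Zfun_iff)
    then have "(\<lambda>n. (?L - p (Suc n) * X n * f (Suc (Suc n))) / f (Suc n)) \<longlonglongrightarrow> (?L - 0 * 1) / 1"
      by (intro tendsto_intros fS) auto
    moreover have "\<forall>\<^sub>F n in sequentially. (?L - p (Suc n) * X n * f (Suc (Suc n))) / f (Suc n) = X (Suc n)"
    proof -
      have "\<forall>\<^sub>F n in sequentially. f (Suc n) \<noteq> 0"
        using tendsto_imp_eventually_ne[OF fS(1)] by simp
      then show ?thesis
      proof eventually_elim
        case (elim n)
        then show ?case
          using cf_recurrence_invariant[of X p f n, OF X f] by (simp add: field_simps)
      qed
    qed
    ultimately show ?thesis
      using Lim_transform_eventually by force
  qed
  have "(\<lambda>n. cf_num p (\<lambda>_. 1) (Suc n)) \<longlonglongrightarrow> p 0 * f 1"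
    using X_lim[of "cf_num p (\<lambda>_. 1)"] by simp
  then have num: "cf_num p (\<lambda>_. 1) \<longlonglongrightarrow> p 0 * f 1"
    by (rule LIMSEQ_imp_Suc)
  have "(\<lambda>n. cf_den p (\<lambda>_. 1) (Suc n)) \<longlonglongrightarrow> f 0"
    using X_lim[of "cf_den p (\<lambda>_. 1)"] by (simp flip: f)
  then have den: "cf_den p (\<lambda>_. 1) \<longlonglongrightarrow> f 0"
    by (rule LIMSEQ_imp_Suc)
  show ?thesis
    unfolding cf_has_value_def
    using tendsto_imp_eventually_ne[OF den \<open>f 0 \<noteq> 0\<close>] tendsto_divide[OF num den \<open>f 0 \<noteq> 0\<close>] by simp
qed

lemma summable_partial_theta:
  fixes x r :: real
  assumes "0 \<le> r" "r < 1" "0 \<le> x"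
  shows "summable (\<lambda>m. r ^ (m * (m + 1)) * x ^ m)"
proof (rule summable_comparison_test_ev)
  have "(\<lambda>m. r ^ Suc m * x) \<longlonglongrightarrow> 0 * x"
    using assms by (intro tendsto_intros LIMSEQ_Suc LIMSEQ_realpow_zero) auto
  then have "\<forall>\<^sub>F m in sequentially. r ^ Suc m * x < 1 / 2"
    by (rule order_tendstoD) auto
  then show "\<forall>\<^sub>F m in sequentially. norm (r ^ (m * (m + 1)) * x ^ m) \<le> (1 / 2) ^ m"
  proof eventually_elim
    case (elim m)
    have "r ^ (m * (m + 1)) * x ^ m = (r ^ Suc m * x) ^ m"
      by (simp only: power_mult_distrib power_mult[symmetric]) (simp add: mult.commute)
    also have "\<dots> \<le> (1 / 2) ^ m"
      using elim assms by (intro power_mono) auto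
    finally show ?case using assms by simp
  qed
qed (simp add: summable_geometric)

text \<open>
  The tails of \<open>M(c, q^2)\<close> are partial theta series weighted by Gaussian binomials.  For \<open>i = 0\<close>
  the truncated subtraction \<open>m + 0 - 1\<close> leaves only the term \<open>m = 0\<close>, so the tail is the constant
  one; for \<open>i = 1\<close> the tail is the partial theta series itself.
\<close>
definition M_tail_coeff :: "complex \<Rightarrow> nat \<Rightarrow> nat \<Rightarrow> complex" where
  "M_tail_coeff q i m =
     qbin (q\<^sup>2) (if even i then m + i div 2 - 1 else m + i div 2) m * q ^ (m * (m + 1) + 2 * (i div 2) * m)"

definition M_tail :: "complex \<Rightarrow> complex \<Rightarrow> nat \<Rightarrow> complex" where
  "M_tail c q i = (\<Sum>m. M_tail_coeff q i m * c ^ m)"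

context
  fixes c q :: complex
  assumes q: "norm q < 1"
begin

lemma norm_sq_less_1: "norm (q\<^sup>2) < 1"
  using q by (simp add: norm_power power_less_one_iff abs_square_less_1)

lemma M_tail_coeff_bound:
  obtains B where "B > 0"
    "\<And>i m. norm (M_tail_coeff q i m * c ^ m) \<le>
       B * (norm q ^ (2 * m)) ^ (i div 2) * (norm q ^ (m * (m + 1)) * norm c ^ m)"
proof -
  obtain B where B: "B > 0" "\<And>n k. norm (qbin (q\<^sup>2) n k) \<le> B"
    using qbin_bounded[OF norm_sq_less_1] by blast
  have "norm (M_tail_coeff q i m * c ^ m) \<le>
       B * (norm q ^ (2 * m)) ^ (i div 2) * (norm q ^ (m * (m + 1)) * norm c ^ m)" for i m
  proof -
    have e: "norm q ^ (m * (m + 1) + 2 * (i div 2) * m) = (norm q ^ (2 * m)) ^ (i div 2) * norm q ^ (m * (m + 1))"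
      by (simp only: power_add power_mult[symmetric]) (simp only: mult_ac)
    have "norm (M_tail_coeff q i m) \<le> B * norm q ^ (m * (m + 1) + 2 * (i div 2) * m)"
      unfolding M_tail_coeff_def norm_mult norm_power by (intro mult_right_mono B(2)) auto
    then have "norm (M_tail_coeff q i m) * norm c ^ m \<le> B * norm q ^ (m * (m + 1) + 2 * (i div 2) * m) * norm c ^ m"
      by (intro mult_right_mono) auto
    then show ?thesis
      unfolding e by (simp only: norm_mult norm_power mult.assoc)
  qed
  with B(1) show ?thesis by (rule that)
qed

lemma M_tail_summable: "summable (\<lambda>m. norm (M_tail_coeff q i m * c ^ m))"
proof -
  obtain B where B: "B > 0" "\<And>i m. norm (M_tail_coeff q i m * c ^ m) \<le>
       B * (norm q ^ (2 * m)) ^ (i div 2) * (norm q ^ (m * (m + 1)) * norm c ^ m)"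
    using M_tail_coeff_bound by blast
  show ?thesis
  proof (rule summable_comparison_test)
    have "norm (M_tail_coeff q i m * c ^ m) \<le> B * (norm q ^ (m * (m + 1)) * norm c ^ m)" for m
    proof -
      have "B * (norm q ^ (2 * m)) ^ (i div 2) \<le> B"
        using q B(1) by (simp add: power_le_one)
      then show ?thesis
        by (intro order_trans[OF B(2)] mult_right_mono) auto
    qed
    then show "\<exists>N. \<forall>m\<ge>N. norm (norm (M_tail_coeff q i m * c ^ m)) \<le> B * (norm q ^ (m * (m + 1)) * norm c ^ m)"
      by simp
    show "summable (\<lambda>m. B * (norm q ^ (m * (m + 1)) * norm c ^ m))"
      using q by (intro summable_mult summable_partial_theta) auto
  qed
qed

text \<open>
  Compared coefficient by coefficient in \<open>c\<close>, this is a Pascal rule for even \<open>i\<close> and the absorption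
  identity for odd \<open>i\<close>; the factor \<open>c\<close> in the partial numerator shifts the coefficient index by one.
\<close>
lemma M_tail_recurrence:
  "M_tail c q i = M_tail c q (Suc i) + M_numerator c (q\<^sup>2) (Suc i) * M_tail c q (Suc (Suc i))"
proof -
  have S: "summable (\<lambda>m. M_tail_coeff q i m * c ^ m)" for i
    using M_tail_summable by (rule summable_norm_cancel)
  have coeff_0: "M_tail_coeff q i 0 = M_tail_coeff q (Suc i) 0"
    using norm_sq_less_1 by (simp add: M_tail_coeff_def)
  have coeff_Suc: "(M_tail_coeff q i (Suc m) - M_tail_coeff q (Suc i) (Suc m)) * c =
     M_numerator c (q\<^sup>2) (Suc i) * M_tail_coeff q (Suc (Suc i)) m" for m
  proof (cases "even i")
    case True
    then obtain n where i: "i = 2 * n" by (elim evenE)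
    have e: "q ^ (Suc m * (Suc m + 1) + 2 * n * Suc m) * q ^ (2 * n) =
             q ^ (4 * n + 2) * q ^ (m * (m + 1) + 2 * Suc n * m)"
      by (simp add: algebra_simps flip: power_add)
    have "4 * n + 2 = 2 * Suc (2 * n)" by simp
    then have p: "M_numerator c (q\<^sup>2) (Suc i) = - c * q ^ (4 * n + 2)"
      by (simp only: M_numerator_def i power_mult) simp
    define X where "X = q ^ (Suc m * (Suc m + 1) + 2 * n * Suc m)"
    have "M_tail_coeff q i (Suc m) = qbin (q\<^sup>2) (n + m) (Suc m) * X"
      "M_tail_coeff q (Suc i) (Suc m) = qbin (q\<^sup>2) (Suc (n + m)) (Suc m) * X"
      by (simp_all add: M_tail_coeff_def i X_def add.commute)
    then have "M_tail_coeff q i (Suc m) - M_tail_coeff q (Suc i) (Suc m) =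
        - (q ^ (2 * n) * qbin (q\<^sup>2) (n + m) m) * X"
      unfolding qbin_Suc_Suc'[OF norm_sq_less_1] power_mult by (simp only:) (simp add: ring_distribs)
    also have "\<dots> = - (q ^ (4 * n + 2)) * (qbin (q\<^sup>2) (n + m) m * q ^ (m * (m + 1) + 2 * Suc n * m))"
      using arg_cong[OF e[folded X_def], of "\<lambda>t. - qbin (q\<^sup>2) (n + m) m * t"] by (simp only: mult_ac minus_mult_commute mult_minus_left mult_minus_right)
    also have "qbin (q\<^sup>2) (n + m) m * q ^ (m * (m + 1) + 2 * Suc n * m) = M_tail_coeff q (Suc (Suc i)) m"
      by (simp add: M_tail_coeff_def i add.commute)
    finally show ?thesis by (simp add: p)
  next
    case False
    then obtain n where i: "i = 2 * n + 1" by (elim oddE)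
    have e: "q ^ (Suc m * (Suc m + 1) + 2 * n * Suc m) =
             q ^ (2 * Suc n) * q ^ (m * (m + 1) + 2 * Suc n * m)"
      by (simp add: algebra_simps flip: power_add)
    have e': "q ^ (Suc m * (Suc m + 1) + 2 * Suc n * Suc m) =
       (q\<^sup>2) ^ Suc m * q ^ (Suc m * (Suc m + 1) + 2 * n * Suc m)"
      by (simp only: power_add[symmetric] power_mult[symmetric]) (simp add: algebra_simps)
    have p: "M_numerator c (q\<^sup>2) (Suc i) = c * q ^ (2 * Suc n) * (1 - (q\<^sup>2) ^ Suc n)"
    proof -
      have "Suc i = 2 * Suc n" by (simp add: i)
      moreover have "2 * Suc n div 2 = Suc n" by simp
      moreover have "(q\<^sup>2) ^ (2 * Suc n) = (q\<^sup>2) ^ Suc n * (q\<^sup>2) ^ Suc n"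
        by (simp only: mult_2 power_add)
      moreover have "q ^ (2 * Suc n) = (q\<^sup>2) ^ Suc n"
        by (simp only: power_mult)
      ultimately show ?thesis
        by (simp only: M_numerator_def) (simp add: right_diff_distrib del: power_Suc)
    qed
    define X where "X = q ^ (Suc m * (Suc m + 1) + 2 * n * Suc m)"
    have "M_tail_coeff q i (Suc m) = qbin (q\<^sup>2) (n + Suc m) (Suc m) * X"
      by (simp add: M_tail_coeff_def i X_def add.commute)
    moreover have "M_tail_coeff q (Suc i) (Suc m) = qbin (q\<^sup>2) (n + Suc m) (Suc m) * ((q\<^sup>2) ^ Suc m * X)"
      unfolding X_def e'[symmetric] by (simp add: M_tail_coeff_def i add.commute)
    ultimately have "M_tail_coeff q i (Suc m) - M_tail_coeff q (Suc i) (Suc m) =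
        (1 - (q\<^sup>2) ^ Suc m) * qbin (q\<^sup>2) (n + Suc m) (Suc m) * X"
      by (simp only:) (simp add: ring_distribs del: power_Suc)
    also have "\<dots> = q ^ (2 * Suc n) * (1 - (q\<^sup>2) ^ Suc n) * (qbin (q\<^sup>2) (n + Suc m) m * q ^ (m * (m + 1) + 2 * Suc n * m))"
      unfolding qbin_absorb[OF norm_sq_less_1] X_def e by (simp only: mult_ac)
    also have "qbin (q\<^sup>2) (n + Suc m) m * q ^ (m * (m + 1) + 2 * Suc n * m) = M_tail_coeff q (Suc (Suc i)) m"
      by (simp add: M_tail_coeff_def i add.commute)
    finally show ?thesis by (simp only: p mult_ac)
  qed
  have "M_tail c q i - M_tail c q (Suc i) =
      (\<Sum>m. (M_tail_coeff q i m - M_tail_coeff q (Suc i) m) * c ^ m)"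
    unfolding M_tail_def using suminf_diff[OF S S, of i "Suc i"] by (simp add: algebra_simps)
  also have "\<dots> = (\<Sum>m. (M_tail_coeff q i (Suc m) - M_tail_coeff q (Suc i) (Suc m)) * c ^ Suc m)"
    using suminf_split_head[OF summable_diff[OF S S], of i "Suc i"] coeff_0 by (simp add: algebra_simps)
  also have "\<dots> = (\<Sum>m. M_numerator c (q\<^sup>2) (Suc i) * (M_tail_coeff q (Suc (Suc i)) m * c ^ m))"
    using coeff_Suc by (simp add: mult.assoc flip: mult.assoc[of _ c])
  also have "\<dots> = M_numerator c (q\<^sup>2) (Suc i) * M_tail c q (Suc (Suc i))"
    unfolding M_tail_def by (rule suminf_mult[OF S])
  finally show ?thesis by (simp add: algebra_simps)
qed

text \<open>
  As \<open>i\<close> grows, the factor \<open>q^(2 (i div 2) m)\<close> extinguishes every term except \<open>m = 0\<close>.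
\<close>
lemma M_tail_LIMSEQ: "M_tail c q \<longlonglongrightarrow> 1"
proof -
  obtain B where B: "B > 0" "\<And>i m. norm (M_tail_coeff q i m * c ^ m) \<le>
       B * (norm q ^ (2 * m)) ^ (i div 2) * (norm q ^ (m * (m + 1)) * norm c ^ m)"
    using M_tail_coeff_bound by blast
  define M where "M m = norm q ^ (m * (m + 1)) * norm c ^ m" for m
  have half: "filterlim (\<lambda>i::nat. i div 2) at_top at_top"
    unfolding filterlim_at_top eventually_sequentially
  proof
    show "\<exists>N. \<forall>n\<ge>N. Z \<le> n div 2" for Z :: nat
      by (rule exI[of _ "2 * Z"]) auto
  qed
  have lim: "(\<lambda>i. M_tail_coeff q i m * c ^ m) \<longlonglongrightarrow> (if m = 0 then 1 else 0)" for m
  proof (cases "m = 0")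
    case True
    then show ?thesis using norm_sq_less_1 by (simp add: M_tail_coeff_def)
  next
    case False
    have "(\<lambda>i. B * (norm q ^ (2 * m)) ^ (i div 2) * M m) \<longlonglongrightarrow> B * 0 * M m"
      using False q by (intro tendsto_intros filterlim_compose[OF LIMSEQ_realpow_zero half]) (auto simp: power_less_one_iff)
    then have "(\<lambda>i. B * (norm q ^ (2 * m)) ^ (i div 2) * M m) \<longlonglongrightarrow> 0"
      by simp
    then have "(\<lambda>i. M_tail_coeff q i m * c ^ m) \<longlonglongrightarrow> 0"
      by (rule Lim_null_comparison[rotated]) (simp only: M_def B(2) eventually_True)
    then show ?thesis using False by simp
  qed
  have "(\<lambda>i. \<Sum>m. M_tail_coeff q i m * c ^ m) \<longlonglongrightarrow> (\<Sum>m. if m = 0 then 1 else 0)"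
  proof (rule conjunct2[OF conjunct2[OF tannerys_theorem[where M = "\<lambda>m. B * M m", OF lim]]])
    have "norm (M_tail_coeff q i m * c ^ m) \<le> B * M m" for i m
    proof -
      have "B * (norm q ^ (2 * m)) ^ (i div 2) \<le> B"
        using q B(1) by (simp add: power_le_one)
      then show ?thesis
        unfolding M_def by (intro order_trans[OF B(2)] mult_right_mono) auto
    qed
    then show "\<forall>\<^sub>F (m, i) in at_top \<times>\<^sub>F sequentially. norm (M_tail_coeff q i m * c ^ m) \<le> B * M m"
      by (simp add: always_eventually)
    show "summable (\<lambda>m. B * M m)"
      unfolding M_def using q by (intro summable_mult summable_partial_theta) auto
  qed simp
  also have "(\<Sum>m. if m = 0 then 1 else 0) = (1 :: complex)"
    using suminf_finite[of "{0}" "\<lambda>m::nat. if m = 0 then 1 else (0::complex)"] by simp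
  finally show ?thesis by (simp add: M_tail_def[abs_def])
qed

lemma M_numerator_summable: "summable (\<lambda>n. norm (M_numerator c (q\<^sup>2) n))"
proof (rule summable_comparison_test)
  have "norm (M_numerator c (q\<^sup>2) n) \<le> (1 + 2 * norm c) * norm q ^ n" for n
  proof (cases "n = 0")
    case False
    have le: "norm q ^ (2 * n) \<le> norm q ^ n"
      using q by (intro power_decreasing) auto
    show ?thesis
    proof (cases "even n")
      case True
      have "norm (M_numerator c (q\<^sup>2) n) = norm c * norm (q ^ n - q ^ (2 * n))"
        using True False by (simp add: M_numerator_def norm_mult flip: power_mult)
      also have "norm (q ^ n - q ^ (2 * n)) \<le> norm q ^ n + norm q ^ (2 * n)"
        using norm_triangle_ineq4[of "q ^ n" "q ^ (2 * n)"] by (simp add: norm_power)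
      also have "\<dots> \<le> 2 * norm q ^ n" using le by simp
      finally have "norm (M_numerator c (q\<^sup>2) n) \<le> norm c * (2 * norm q ^ n)"
        by (simp add: mult_left_mono)
      then show ?thesis by (simp add: algebra_simps add_increasing)
    next
      case odd: False
      have "norm (M_numerator c (q\<^sup>2) n) = norm c * norm q ^ (2 * n)"
        using odd False by (simp add: M_numerator_def norm_mult norm_power flip: power_mult)
      also have "\<dots> \<le> norm c * norm q ^ n" using le by (simp add: mult_left_mono)
      also have "\<dots> \<le> (1 + 2 * norm c) * norm q ^ n"
        by (intro mult_right_mono) auto
      finally show ?thesis .
    qed
  qed (simp add: M_numerator_def)
  then show "\<exists>N. \<forall>n\<ge>N. norm (norm (M_numerator c (q\<^sup>2) n)) \<le> (1 + 2 * norm c) * norm q ^ n"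
    by simp
  show "summable (\<lambda>n. (1 + 2 * norm c) * norm q ^ n)"
    using q by (intro summable_mult summable_geometric) auto
qed

lemma M_tail_0: "M_tail c q 0 = 1"
proof -
  have "M_tail c q 0 = (\<Sum>m. if m = 0 then 1 else 0)"
    unfolding M_tail_def using norm_sq_less_1
    by (intro suminf_cong) (auto simp: M_tail_coeff_def)
  then show ?thesis
    using suminf_finite[of "{0}" "\<lambda>m::nat. if m = 0 then 1 else (0::complex)"] by simp
qed

text \<open>
  The tail of index zero equals one, so the value of the continued fraction is the tail of index one.
\<close>
lemma M_has_value_partial_theta: "M_has_value c (q\<^sup>2) (\<Sum>m. q ^ (m * (m + 1)) * c ^ m)"
proof -
  have "M_tail c q 1 = (\<Sum>m. q ^ (m * (m + 1)) * c ^ m)"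
    using norm_sq_less_1 by (simp add: M_tail_def M_tail_coeff_def)
  moreover have "M_has_value c (q\<^sup>2) (M_numerator c (q\<^sup>2) 0 * M_tail c q 1 / M_tail c q 0)"
    unfolding M_has_value_def
    by (rule cf_has_value_tails[OF M_numerator_summable M_tail_recurrence M_tail_LIMSEQ]) (simp add: M_tail_0)
  ultimately show ?thesis by (simp add: M_tail_0 M_numerator_def)
qed

end

section \<open>Theta series and the triple product\<close>

text \<open>
  The series \<open>sum z^n q^(n^2)\<close> in the logarithmic variables \<open>z = exp u\<close> and \<open>q = exp w\<close>, in which the
  quarter powers of \<open>q\<close> below are single-valued.
\<close>
definition theta_term :: "complex \<Rightarrow> complex \<Rightarrow> int \<Rightarrow> complex" where
  "theta_term u w n = exp (u * of_int n + w * (of_int n)\<^sup>2)"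

definition theta :: "complex \<Rightarrow> complex \<Rightarrow> complex" where
  "theta u w = infsum (theta_term u w) UNIV"

text \<open>
  A majorant of \<open>theta_term\<close> that is uniform on \<open>\<bar>Re u\<bar> \<le> A\<close>, \<open>Re w \<le> - d\<close>: completing the square
  gives \<open>A t - d t^2 \<le> (A + 1)^2 / (4 d) - t\<close>.
\<close>
definition gauss_bound :: "real \<Rightarrow> real \<Rightarrow> int \<Rightarrow> real" where
  "gauss_bound A d n = exp ((A + 1)\<^sup>2 / (4 * d)) * exp (- \<bar>of_int n\<bar>)"

lemma gauss_bound_summable: "gauss_bound A d summable_on UNIV"
proof -
  have nat: "(\<lambda>n::nat. exp (- real n)) summable_on UNIV"
  proof (rule norm_summable_imp_summable_on)
    have "summable (\<lambda>n. exp (- 1 :: real) ^ n)"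
      by (rule summable_geometric) simp
    then show "summable (\<lambda>n. norm (exp (- real n)))"
      by (simp flip: exp_of_nat_mult)
  qed
  have 1: "(\<lambda>n. exp (- \<bar>of_int n :: real\<bar>)) summable_on range (\<lambda>n. int n)"
    by (subst summable_on_reindex) (use nat in \<open>auto simp: o_def inj_on_def\<close>)
  have 2: "(\<lambda>n. exp (- \<bar>of_int n :: real\<bar>)) summable_on range (\<lambda>n. - int n)"
    by (subst summable_on_reindex) (use nat in \<open>auto simp: o_def inj_on_def\<close>)
  have U: "(UNIV :: int set) = range (\<lambda>n. int n) \<union> range (\<lambda>n. - int n)"
    by (auto intro: int_cases2)
  have "(\<lambda>n. exp (- \<bar>of_int n :: real\<bar>)) summable_on UNIV"
    unfolding U by (rule summable_on_union[OF 1 2])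
  then show ?thesis
    unfolding gauss_bound_def by (rule summable_on_cmult_right)
qed

lemma norm_theta_term_le:
  assumes "d > 0" "\<bar>Re u\<bar> \<le> A" "Re w \<le> - d"
  shows "norm (theta_term u w n) \<le> gauss_bound A d n"
proof -
  define t :: real where "t = \<bar>of_int n\<bar>"
  have t: "t \<ge> 0" "(of_int n)\<^sup>2 = t\<^sup>2" by (auto simp: t_def)
  have "(of_int n :: complex) = of_real (of_int n)" by simp
  then have "Re (u * of_int n + w * (of_int n)\<^sup>2) = Re u * of_int n + Re w * t\<^sup>2"
    unfolding t(2)[symmetric] by (simp flip: of_real_power del: of_real_of_int_eq)
  also have "Re u * of_int n \<le> A * t"
    unfolding t_def using assms by (rule_tac order_trans[OF abs_ge_self]) (simp add: abs_mult mult_right_mono)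
  also have "Re w * t\<^sup>2 \<le> - d * t\<^sup>2"
    using assms by (intro mult_right_mono) auto
  also have "A * t + - d * t\<^sup>2 \<le> (A + 1)\<^sup>2 / (4 * d) - t"
  proof -
    have "0 \<le> (A + 1 - 2 * d * t)\<^sup>2 / (4 * d)" using assms by simp
    also have "\<dots> = (A + 1)\<^sup>2 / (4 * d) - (A + 1) * t + d * t\<^sup>2"
      using assms by (simp add: power2_eq_square field_simps)
    finally show ?thesis by (simp add: algebra_simps)
  qed
  finally have "exp (Re (u * of_int n + w * (of_int n)\<^sup>2)) \<le> exp ((A + 1)\<^sup>2 / (4 * d) - t)"
    by simp
  then show ?thesis
    by (simp add: theta_term_def gauss_bound_def t_def exp_diff exp_minus field_simps del: Re_complex_of_real)
qed

lemma theta_abs_summable: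
  assumes "Re w < 0"
  shows "(\<lambda>n. norm (theta_term u w n)) summable_on UNIV"
proof (rule Infinite_Sum.abs_summable_on_comparison_test)
  show "(\<lambda>n. norm (gauss_bound \<bar>Re u\<bar> (- Re w) n)) summable_on UNIV"
    using gauss_bound_summable summable_on_iff_abs_summable_on_real by blast
  show "norm (theta_term u w n) \<le> norm (gauss_bound \<bar>Re u\<bar> (- Re w) n)" for n
    using norm_theta_term_le[of "- Re w" u "\<bar>Re u\<bar>" w n] assms by (auto intro: order_trans)
qed

lemma theta_has_sum:
  assumes "Re w < 0"
  shows "(theta_term u w has_sum theta u w) UNIV"
  unfolding theta_def by (rule has_sum_infsum[OF Infinite_Sum.abs_summable_summable[OF theta_abs_summable[OF assms]]])

lemma theta_periodic: "theta (u + 2 * of_real pi * \<i>) w = theta u w"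
proof -
  have "theta_term (u + 2 * of_real pi * \<i>) w n = theta_term u w n" for n
  proof -
    have "exp (2 * of_real pi * \<i> * of_int n) = (1 :: complex)"
      by (auto simp: exp_eq_1 intro!: exI[of _ n])
    then show ?thesis
      by (simp add: theta_term_def ring_distribs exp_add)
  qed
  then have "theta_term (u + 2 * of_real pi * \<i>) w = theta_term u w" by (rule ext)
  then show ?thesis by (simp only: theta_def)
qed

lemma theta_minus: "theta (- u) w = theta u w"
proof -
  have "theta (- u) w = infsum (theta_term u w \<circ> uminus) UNIV"
    unfolding theta_def by (rule infsum_cong) (simp add: theta_term_def)
  also have "\<dots> = infsum (theta_term u w) (range uminus)"
    by (rule infsum_reindex[symmetric]) (simp add: inj_on_def)
  finally show ?thesis by (simp add: theta_def)
qed

lemma theta_shift: "theta (u + 2 * w) w = exp (- u - w) * theta u w"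
proof -
  have e: "theta_term (u + 2 * w) w n = exp (- u - w) * theta_term u w (n + 1)" for n
    unfolding theta_term_def by (simp add: power2_eq_square algebra_simps flip: exp_add)
  have "theta (u + 2 * w) w = exp (- u - w) * infsum (theta_term u w \<circ> (\<lambda>n. n + 1)) UNIV"
    unfolding theta_def e o_def by (rule infsum_cmult_right')
  also have "infsum (theta_term u w \<circ> (\<lambda>n. n + 1)) UNIV = infsum (theta_term u w) (range (\<lambda>n. n + 1))"
    by (rule infsum_reindex[symmetric]) (simp add: inj_on_def)
  also have "range (\<lambda>n::int. n + 1) = UNIV"
    by (metis surjI diff_add_cancel)
  finally show ?thesis by (simp add: theta_def)
qed

text \<open>
  The point \<open>pi i + w\<close> is mapped to itself by a reflection combined with periods, under which the
  series changes sign.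
\<close>
lemma theta_pi_shift_zero: "theta (of_real pi * \<i> + w) w = 0"
proof -
  have "theta (of_real pi * \<i> + w) w = theta ((- (of_real pi * \<i>) + w) + 2 * of_real pi * \<i>) w"
    by (rule arg_cong[where f = "\<lambda>u. theta u w"]) simp
  also have "\<dots> = theta (- (of_real pi * \<i> - w)) w"
    unfolding theta_periodic by (rule arg_cong[where f = "\<lambda>u. theta u w"]) simp
  also have "\<dots> = theta (of_real pi * \<i> - w) w"
    by (rule theta_minus)
  finally have 1: "theta (of_real pi * \<i> + w) w = theta (of_real pi * \<i> - w) w" .
  have "theta (of_real pi * \<i> + w) w = theta ((of_real pi * \<i> - w) + 2 * w) w"
    by (rule arg_cong[where f = "\<lambda>u. theta u w"]) simp
  also have "\<dots> = exp (- (of_real pi * \<i>)) * theta (of_real pi * \<i> - w) w"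
    unfolding theta_shift by simp
  also have "exp (- (of_real pi * \<i>)) = -1"
    by (simp add: exp_minus mult.commute)
  finally show ?thesis using 1 by simp
qed

lemma has_sum_product:
  fixes f :: "'a \<Rightarrow> complex" and g :: "'b \<Rightarrow> complex"
  assumes f: "(f has_sum a) UNIV" "(\<lambda>x. norm (f x)) summable_on UNIV"
    and g: "(g has_sum b) UNIV" "(\<lambda>y. norm (g y)) summable_on UNIV"
  shows "((\<lambda>(x, y). f x * g y) has_sum a * b) UNIV"
proof -
  have "((\<lambda>(x, y). f x * g y) has_sum a * b) (UNIV \<times> UNIV)"
  proof (rule has_sum_SigmaI)
    show "((\<lambda>y. case (x, y) of (x, y) \<Rightarrow> f x * g y) has_sum f x * b) UNIV" for x
      using g(1) by (auto intro: has_sum_cmult_right)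
    show "((\<lambda>x. f x * b) has_sum a * b) UNIV"
      using f(1) by (rule has_sum_cmult_left)
    have eq: "(\<Sum>\<^sub>\<infinity>y. norm (f x * g y)) = norm (f x) * (\<Sum>\<^sub>\<infinity>y. norm (g y))" for x
      by (simp add: norm_mult infsum_cmult_right')
    have outer: "(\<lambda>x. norm (\<Sum>\<^sub>\<infinity>y. norm (f x * g y))) summable_on UNIV"
      unfolding eq using summable_on_cmult_left[OF f(2), of "\<bar>\<Sum>\<^sub>\<infinity>y. norm (g y)\<bar>"] by (simp add: abs_mult)
    have inner: "(\<lambda>y. norm (f x * g y)) summable_on UNIV" for x
      using g(2) by (simp add: norm_mult summable_on_cmult_right)
    have "(\<lambda>z. norm (case z of (x, y) \<Rightarrow> f x * g y)) summable_on (UNIV \<times> UNIV)"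
      unfolding Infinite_Sum.abs_summable_on_Sigma_iff prod.case using inner outer by blast
    then have "(\<lambda>(x, y). f x * g y) summable_on (UNIV \<times> UNIV)"
      by (rule Infinite_Sum.abs_summable_summable)
    then show "(\<lambda>(x, y). f x * g y) summable_on (UNIV \<times> UNIV)" .
  qed
  then show ?thesis by simp
qed

text \<open>
  The substitution \<open>(m, n) = (r + s, r - s)\<close> reaches exactly the pairs of even sum and
  \<open>(r + s + 1, r - s)\<close> those of odd sum; both diagonalise \<open>m^2 + n^2\<close>.  All quadratic relations
  between the theta constants are instances.
\<close>
lemma theta_mult:
  assumes "Re w < 0"
  shows "theta u w * theta v w =
    theta (u + v) (2 * w) * theta (u - v) (2 * w) +
    exp (u + w) * (theta (u + v + 2 * w) (2 * w) * theta (u - v + 2 * w) (2 * w))"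
proof (rule has_sum_unique)
  define h where "h = (\<lambda>(m, n). theta_term u w m * theta_term v w n)"
  have w2: "Re (2 * w) < 0" using assms by simp
  note S = has_sum_product[OF theta_has_sum theta_abs_summable theta_has_sum theta_abs_summable]
  show "(h has_sum theta u w * theta v w) UNIV"
    unfolding h_def by (rule S[OF assms assms assms assms])
  have even: "(h has_sum theta (u + v) (2 * w) * theta (u - v) (2 * w)) {(m, n). even (m + n)}"
  proof (rule has_sum_reindex_bij_witness[where i = "\<lambda>(m, n). ((m + n) div 2, (m - n) div 2)"
        and j = "\<lambda>(r, s). (r + s, r - s)", THEN iffD1])
    show "((\<lambda>(r, s). theta_term (u + v) (2 * w) r * theta_term (u - v) (2 * w) s) has_sum
        theta (u + v) (2 * w) * theta (u - v) (2 * w)) UNIV"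
      by (rule S[OF w2 w2 w2 w2])
    show "h (case a of (r, s) \<Rightarrow> (r + s, r - s)) = ((\<lambda>(r, s). theta_term (u + v) (2 * w) r * theta_term (u - v) (2 * w) s)) a" for a
      by (cases a) (simp add: h_def theta_term_def power2_eq_square algebra_simps flip: exp_add)
    show "(case (case b of (m, n) \<Rightarrow> ((m + n) div 2, (m - n) div 2)) of (r, s) \<Rightarrow> (r + s, r - s)) = b"
      if b: "b \<in> {(m, n). even (m + n)}" for b :: "int \<times> int"
    proof -
      obtain m n where mn: "b = (m, n)" by (cases b)
      then have "even (m + n)" using b by simp
      then obtain k where "m + n = 2 * k" by (rule evenE)
      then have n: "n = 2 * k - m" by simp
      show ?thesis unfolding mn n by simp
    qed
    show "(case (case a of (r, s) \<Rightarrow> (r + s, r - s)) of (m, n) \<Rightarrow> ((m + n) div 2, (m - n) div 2)) = a"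
      for a :: "int \<times> int"
      by (cases a) simp
    show "(case a of (r, s) \<Rightarrow> (r + s, r - s)) \<in> {(m, n). even (m + n)}" for a :: "int \<times> int"
      by (cases a) simp
  qed simp_all
  have odd: "(h has_sum exp (u + w) * (theta (u + v + 2 * w) (2 * w) * theta (u - v + 2 * w) (2 * w))) {(m, n). odd (m + n)}"
  proof (rule has_sum_reindex_bij_witness[where i = "\<lambda>(m, n). ((m + n - 1) div 2, (m - n - 1) div 2)"
        and j = "\<lambda>(r, s). (r + s + 1, r - s)", THEN iffD1])
    show "((\<lambda>a. exp (u + w) * (case a of (r, s) \<Rightarrow> theta_term (u + v + 2 * w) (2 * w) r * theta_term (u - v + 2 * w) (2 * w) s)) has_sum
        exp (u + w) * (theta (u + v + 2 * w) (2 * w) * theta (u - v + 2 * w) (2 * w))) UNIV"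
      by (rule has_sum_cmult_right[OF S[OF w2 w2 w2 w2]])
    show "h (case a of (r, s) \<Rightarrow> (r + s + 1, r - s)) = ((\<lambda>a. exp (u + w) * (case a of (r, s) \<Rightarrow> theta_term (u + v + 2 * w) (2 * w) r * theta_term (u - v + 2 * w) (2 * w) s))) a" for a
      by (cases a) (simp add: h_def theta_term_def power2_eq_square algebra_simps flip: exp_add)
    show "(case (case b of (m, n) \<Rightarrow> ((m + n - 1) div 2, (m - n - 1) div 2)) of (r, s) \<Rightarrow> (r + s + 1, r - s)) = b"
      if b: "b \<in> {(m, n). odd (m + n)}" for b :: "int \<times> int"
    proof -
      obtain m n where mn: "b = (m, n)" by (cases b)
      then have "odd (m + n)" using b by simp
      then obtain k where "m + n = 2 * k + 1" by (rule oddE)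
      then have n: "n = 2 * k + 1 - m" by simp
      show ?thesis unfolding mn n by simp
    qed
    show "(case (case a of (r, s) \<Rightarrow> (r + s + 1, r - s)) of (m, n) \<Rightarrow> ((m + n - 1) div 2, (m - n - 1) div 2)) = a"
      for a :: "int \<times> int"
      by (cases a) simp
    show "(case a of (r, s) \<Rightarrow> (r + s + 1, r - s)) \<in> {(m, n). odd (m + n)}" for a :: "int \<times> int"
      by (cases a) simp
  qed simp_all
  have "(h has_sum (theta (u + v) (2 * w) * theta (u - v) (2 * w) +
     exp (u + w) * (theta (u + v + 2 * w) (2 * w) * theta (u - v + 2 * w) (2 * w))))
     ({(m, n). even (m + n)} \<union> {(m, n). odd (m + n)})"
    by (rule has_sum_Un_disjoint[OF even odd]) auto
  also have "{(m, n). even (m + n)} \<union> {(m, n). odd (m + n)} = (UNIV :: (int \<times> int) set)"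
    by auto
  finally show "(h has_sum (theta (u + v) (2 * w) * theta (u - v) (2 * w) +
     exp (u + w) * (theta (u + v + 2 * w) (2 * w) * theta (u - v + 2 * w) (2 * w)))) UNIV" .
qed

lemma theta_holomorphic:
  assumes g: "g holomorphic_on {w. Re w < 0}"
  shows "(\<lambda>w. theta (g w) w) holomorphic_on {w. Re w < 0}"
proof -
  have op: "open {w. Re w < 0}" by (rule open_halfspace_Re_lt)
  have "(\<lambda>w. theta (g w) w) field_differentiable at z" if z: "Re z < 0" for z
  proof -
    obtain r where r: "r > 0" "cball z r \<subseteq> {w. Re w < 0}"
      using op z open_contains_cball by blast
    have comp: "compact (cball z r)" by simp
    have "continuous_on (cball z r) (\<lambda>w. Re (g w))"
      using g r by (intro continuous_intros holomorphic_on_imp_continuous_on) (rule holomorphic_on_subset)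
    then have "bounded ((\<lambda>w. Re (g w)) ` cball z r)"
      by (intro compact_imp_bounded compact_continuous_image comp)
    then obtain A where A: "\<And>w. w \<in> cball z r \<Longrightarrow> \<bar>Re (g w)\<bar> \<le> A"
      unfolding bounded_iff by (auto simp del: mem_cball)
    have "\<exists>w0\<in>cball z r. \<forall>w\<in>cball z r. Re w \<le> Re w0"
      using r(1) by (intro continuous_attains_sup comp continuous_intros) auto
    then obtain w0 where w0: "w0 \<in> cball z r" "\<And>w. w \<in> cball z r \<Longrightarrow> Re w \<le> Re w0" by blast
    have w0_neg: "Re w0 < 0" using w0(1) r by auto
    have "uniform_limit (cball z r) (\<lambda>X w. \<Sum>n\<in>X. theta_term (g w) w n) (\<lambda>w. theta (g w) w) (finite_subsets_at_top UNIV)"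
      unfolding theta_def
      by (rule Weierstrass_m_test_general[OF norm_theta_term_le[where d = "- Re w0" and A = A] gauss_bound_summable])
         (use w0_neg A w0(2) in auto)
    moreover have "continuous_on (cball z r) (\<lambda>w. \<Sum>n\<in>X. theta_term (g w) w n) \<and>
        (\<lambda>w. \<Sum>n\<in>X. theta_term (g w) w n) holomorphic_on ball z r" for X
    proof -
      have "(\<lambda>w. \<Sum>n\<in>X. theta_term (g w) w n) holomorphic_on {w. Re w < 0}"
        unfolding theta_term_def by (intro holomorphic_intros g)
      then have "(\<lambda>w. \<Sum>n\<in>X. theta_term (g w) w n) holomorphic_on cball z r"
        using r(2) by (rule holomorphic_on_subset)
      then show ?thesis
        using holomorphic_on_imp_continuous_on holomorphic_on_subset[OF _ ball_subset_cball] by blast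
    qed
    ultimately have "(\<lambda>w. theta (g w) w) holomorphic_on ball z r"
      using holomorphic_uniform_limit[OF always_eventually, where z = z and r = r and g = "\<lambda>w. theta (g w) w"
          and f = "\<lambda>X w. \<Sum>n\<in>X. theta_term (g w) w n" and F = "finite_subsets_at_top UNIV"]
      by (metis finite_subsets_at_top_neq_bot)
    then show ?thesis
      using r(1) by (intro holomorphic_on_imp_differentiable_at[of _ "ball z r"]) auto
  qed
  then show ?thesis
    by (auto simp: holomorphic_on_def intro: field_differentiable_at_within)
qed

lemma prod_lessThan_add:
  fixes f :: "nat \<Rightarrow> 'a :: comm_monoid_mult"
  shows "(\<Prod>j<m + n. f j) = (\<Prod>j<m. f j) * (\<Prod>j<n. f (m + j))"
  by (induction n) (simp_all add: mult.assoc)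

text \<open>
  The binomial theorem with \<open>2 n\<close> factors, recentred: the lower half of the factors is reversed and
  each is divided by its leading term.
\<close>
lemma finite_triple_product:
  assumes "Re w < 0"
  shows "(\<Prod>j<n. 1 + (exp u * exp w) * ((exp w)\<^sup>2) ^ j) * (\<Prod>j<n. 1 + (exp (- u) * exp w) * ((exp w)\<^sup>2) ^ j) =
     (\<Sum>k\<in>{- int n..int n}. qbin ((exp w)\<^sup>2) (2 * n) (nat (int n + k)) * theta_term u w k)"
proof -
  define q where "q = exp w"
  have q: "norm (q\<^sup>2) < 1"
    using assms by (simp add: q_def norm_power power_less_one_iff)
  have qpow: "(q\<^sup>2) ^ k = exp (2 * of_nat k * w)" "q ^ k = exp (of_nat k * w)" for k
    by (simp_all add: q_def mult_ac flip: exp_of_nat_mult exp_double)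
  \<comment> \<open>the shift by \<open>- 2 n w\<close> moves the middle factor of the product to \<open>1 + exp u * q\<close>\<close>
  define x where "x = exp (u + w - 2 * of_nat n * w)"
  \<comment> \<open>the product of the leading terms that are split off the lower half\<close>
  define y where "y = exp (of_nat n * u - (of_nat n)\<^sup>2 * w)"
  have y_prod: "(\<Prod>j<m. exp (u - w - 2 * of_nat j * w)) = exp (of_nat m * u - (of_nat m)\<^sup>2 * w)" for m
    by (induction m) (simp_all add: power2_eq_square algebra_simps flip: exp_add)
  have "(\<Prod>j<n + n. 1 + x * (q\<^sup>2) ^ j) = (\<Prod>j<n. 1 + x * (q\<^sup>2) ^ j) * (\<Prod>j<n. 1 + x * (q\<^sup>2) ^ (n + j))"
    by (rule prod_lessThan_add)
  also have "(\<Prod>j<n. 1 + x * (q\<^sup>2) ^ (n + j)) = (\<Prod>j<n. 1 + (exp u * q) * (q\<^sup>2) ^ j)"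
  proof (rule prod.cong)
    show "1 + x * (q\<^sup>2) ^ (n + j) = 1 + (exp u * q) * (q\<^sup>2) ^ j" for j
      unfolding qpow(1) of_nat_add by (simp only: x_def q_def exp_add[symmetric])
        (rule arg_cong[where f = "\<lambda>t. 1 + exp t"], simp add: algebra_simps)
  qed simp
  also have "(\<Prod>j<n. 1 + x * (q\<^sup>2) ^ j) = (\<Prod>j<n. 1 + x * (q\<^sup>2) ^ (n - Suc j))"
    by (rule prod.nat_diff_reindex[symmetric])
  also have "\<dots> = (\<Prod>j<n. exp (u - w - 2 * of_nat j * w) * (1 + (exp (- u) * q) * (q\<^sup>2) ^ j))"
  proof (rule prod.cong)
    fix j assume "j \<in> {..<n}"
    then have j: "of_nat (n - Suc j) = (of_nat n - of_nat j - 1 :: complex)"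
      by (simp add: of_nat_diff)
    have "x * (q\<^sup>2) ^ (n - Suc j) = exp (u - w - 2 * of_nat j * w)"
      unfolding qpow(1) j by (simp only: x_def exp_add[symmetric]) (rule arg_cong[where f = exp], simp add: algebra_simps)
    moreover have "exp (u - w - 2 * of_nat j * w) * ((exp (- u) * q) * (q\<^sup>2) ^ j) = 1"
      unfolding qpow(1) by (simp only: q_def exp_add[symmetric]) simp
    ultimately show "1 + x * (q\<^sup>2) ^ (n - Suc j) = exp (u - w - 2 * of_nat j * w) * (1 + (exp (- u) * q) * (q\<^sup>2) ^ j)"
      by (simp add: distrib_left)
  qed simp
  also have "\<dots> = y * (\<Prod>j<n. 1 + (exp (- u) * q) * (q\<^sup>2) ^ j)"
    by (simp add: prod.distrib y_prod y_def)
  finally have lhs: "(\<Prod>j<2 * n. 1 + x * (q\<^sup>2) ^ j) =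
     y * ((\<Prod>j<n. 1 + (exp u * q) * (q\<^sup>2) ^ j) * (\<Prod>j<n. 1 + (exp (- u) * q) * (q\<^sup>2) ^ j))"
    unfolding mult_2[of n] by (simp only: mult_ac)
  have "q ^ (k * (k - 1)) * x ^ k = y * theta_term u w (int k - int n)" for k
  proof -
    have k: "of_nat (k * (k - 1)) = (of_nat k * (of_nat k - 1) :: complex)"
      by (cases k) (simp_all add: algebra_simps)
    have "x ^ k = exp (of_nat k * (u + w - 2 * of_nat n * w))"
      by (simp only: x_def exp_of_nat_mult)
    then show ?thesis
      unfolding qpow(2) k by (simp only: y_def theta_term_def of_int_diff of_int_of_nat_eq exp_add[symmetric])
        (rule arg_cong[where f = exp], simp add: power2_eq_square algebra_simps)
  qed
  then have "(\<Prod>j<2 * n. 1 + x * (q\<^sup>2) ^ j) = (\<Sum>k\<le>2 * n. qbin (q\<^sup>2) (2 * n) k * (y * theta_term u w (int k - int n)))"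
    unfolding qbin_theorem[OF q] by (simp add: mult.assoc)
  also have "\<dots> = y * (\<Sum>k\<le>2 * n. qbin (q\<^sup>2) (2 * n) k * theta_term u w (int k - int n))"
    by (simp add: sum_distrib_left mult_ac)
  also have "(\<Sum>k\<le>2 * n. qbin (q\<^sup>2) (2 * n) k * theta_term u w (int k - int n)) =
     (\<Sum>k\<in>{- int n..int n}. qbin (q\<^sup>2) (2 * n) (nat (int n + k)) * theta_term u w k)"
    by (rule sum.reindex_bij_witness[of _ "\<lambda>k. nat (int n + k)" "\<lambda>k. int k - int n"]) auto
  finally show ?thesis
    unfolding lhs by (simp add: y_def q_def)
qed

lemma qbin_central_LIMSEQ:
  assumes "norm Q < 1"
  shows "(\<lambda>n. qbin Q (2 * n) (nat (int n + k))) \<longlonglongrightarrow> inverse (qprod (- Q) Q)"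
proof -
  have nz: "qprod (- Q) Q \<noteq> 0" using assms by (intro qprod_nonzero) auto
  have at_top: "filterlim (\<lambda>n. nat (int n + l)) at_top at_top" for l
    unfolding filterlim_at_top eventually_sequentially
  proof
    show "\<exists>N. \<forall>n\<ge>N. Z \<le> nat (int n + l)" for Z
      by (rule exI[of _ "Z + nat \<bar>l\<bar>"]) auto
  qed
  have "filterlim (\<lambda>n::nat. 2 * n) at_top at_top"
    by (rule filterlim_subseq) (simp add: strict_mono_def)
  then have "(\<lambda>n. qfact Q (2 * n) / (qfact Q (nat (int n + k)) * qfact Q (nat (int n + - k)))) \<longlonglongrightarrow>
      qprod (- Q) Q / (qprod (- Q) Q * qprod (- Q) Q)"
    using nz by (intro tendsto_intros filterlim_compose[OF qfact_LIMSEQ[OF assms]] at_top) auto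
  moreover have "\<forall>\<^sub>F n in sequentially. qfact Q (2 * n) / (qfact Q (nat (int n + k)) * qfact Q (nat (int n + - k)))
      = qbin Q (2 * n) (nat (int n + k))"
    using eventually_ge_at_top[of "nat \<bar>k\<bar>"]
  proof eventually_elim
    case (elim n)
    then have "2 * n - nat (int n + k) = nat (int n + - k)" "nat (int n + k) \<le> 2 * n" by auto
    then show ?case by (simp only: qbin_def if_True)
  qed
  ultimately have "(\<lambda>n. qbin Q (2 * n) (nat (int n + k))) \<longlonglongrightarrow> qprod (- Q) Q / (qprod (- Q) Q * qprod (- Q) Q)"
    by (rule Lim_transform_eventually)
  then show ?thesis using nz by (simp add: field_simps)
qed

text \<open>
  The limit of the finite identity: each central Gaussian binomial tends to \<open>1 / (Q; Q)_\<infinity>\<close>, and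
  Tannery's argument allows the termwise passage to the limit.
\<close>
theorem jacobi_triple_product:
  assumes "Re w < 0"
  shows "theta u w = qprod (- ((exp w)\<^sup>2)) ((exp w)\<^sup>2) *
    (qprod (exp u * exp w) ((exp w)\<^sup>2) * qprod (exp (- u) * exp w) ((exp w)\<^sup>2))"
proof -
  define Q where "Q = (exp w)\<^sup>2"
  define P where "P = qprod (- Q) Q"
  have Q: "norm Q < 1"
    using assms by (simp add: Q_def norm_power power_less_one_iff)
  have P: "P \<noteq> 0" unfolding P_def using Q by (intro qprod_nonzero) auto
  define a where "a n k = (if k \<in> {- int n..int n} then qbin Q (2 * n) (nat (int n + k)) * theta_term u w k else 0)" for n k
  have a_sum: "infsum (a n) UNIV = (\<Sum>k\<in>{- int n..int n}. qbin Q (2 * n) (nat (int n + k)) * theta_term u w k)" for n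
  proof -
    have "infsum (a n) UNIV = infsum (\<lambda>k. qbin Q (2 * n) (nat (int n + k)) * theta_term u w k) {- int n..int n}"
      by (rule infsum_cong_neutral) (auto simp: a_def)
    then show ?thesis by simp
  qed
  have a_lim: "(\<lambda>n. a n k) \<longlonglongrightarrow> inverse P * theta_term u w k" for k
  proof (rule Lim_transform_eventually)
    show "(\<lambda>n. qbin Q (2 * n) (nat (int n + k)) * theta_term u w k) \<longlonglongrightarrow> inverse P * theta_term u w k"
      unfolding P_def by (intro tendsto_mult_right qbin_central_LIMSEQ Q)
    show "\<forall>\<^sub>F n in sequentially. qbin Q (2 * n) (nat (int n + k)) * theta_term u w k = a n k"
      using eventually_ge_at_top[of "nat \<bar>k\<bar>"] by eventually_elim (auto simp: a_def)
  qed
  obtain B where B: "B > 0" "\<And>n k. norm (qbin Q n k) \<le> B"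
    using qbin_bounded[OF Q] by blast
  have a_bound: "norm (a n k) \<le> B * gauss_bound \<bar>Re u\<bar> (- Re w) k" for n k
  proof (cases "k \<in> {- int n..int n}")
    case True
    then have "norm (a n k) = norm (qbin Q (2 * n) (nat (int n + k))) * norm (theta_term u w k)"
      by (simp add: a_def norm_mult)
    also have "\<dots> \<le> B * gauss_bound \<bar>Re u\<bar> (- Re w) k"
      using B assms by (intro mult_mono norm_theta_term_le) auto
    finally show ?thesis .
  qed (use B in \<open>auto simp: a_def gauss_bound_def\<close>)
  have "(\<lambda>n. infsum (a n) UNIV) \<longlonglongrightarrow> inverse P * theta u w"
  proof (rule swap_uniform_limit'[where F = "finite_subsets_at_top UNIV"])
    show "\<forall>\<^sub>F X in finite_subsets_at_top UNIV. (\<lambda>n. \<Sum>k\<in>X. a n k) \<longlonglongrightarrow> (\<Sum>k\<in>X. inverse P * theta_term u w k)"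
      by (intro always_eventually allI tendsto_sum a_lim)
    show "((\<lambda>X. \<Sum>k\<in>X. inverse P * theta_term u w k) \<longlongrightarrow> inverse P * theta u w) (finite_subsets_at_top UNIV)"
      using has_sum_cmult_right[OF theta_has_sum[OF assms], of "inverse P" u] by (simp add: has_sum_def)
    show "uniform_limit UNIV (\<lambda>X n. \<Sum>k\<in>X. a n k) (\<lambda>n. infsum (a n) UNIV) (finite_subsets_at_top UNIV)"
      by (rule Weierstrass_m_test_general[OF a_bound summable_on_cmult_right[OF gauss_bound_summable]])
  qed auto
  moreover have "(\<lambda>n. infsum (a n) UNIV) \<longlonglongrightarrow> qprod (exp u * exp w) Q * qprod (exp (- u) * exp w) Q"
    unfolding a_sum unfolding Q_def finite_triple_product[OF assms, symmetric]
    by (intro tendsto_mult qprod_LIMSEQ) (use Q in \<open>simp_all add: Q_def\<close>)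
  ultimately have "inverse P * theta u w = qprod (exp u * exp w) Q * qprod (exp (- u) * exp w) Q"
    by (rule LIMSEQ_unique)
  then show ?thesis using P by (simp add: P_def Q_def field_simps)
qed

section \<open>Theta constants\<close>

definition theta2 :: "complex \<Rightarrow> complex" where
  "theta2 w = exp (w / 4) * theta w w"

definition theta3 :: "complex \<Rightarrow> complex" where
  "theta3 w = theta 0 w"

definition theta4 :: "complex \<Rightarrow> complex" where
  "theta4 w = theta (of_real pi * \<i>) w"

text \<open>
  Gauss' duplication formulas.  Read as \<open>(theta3^2 + theta4^2) / 2 = theta3(2 w)^2\<close> and
  \<open>theta3 * theta4 = theta4(2 w)^2\<close>, they say that doubling \<open>w\<close> is one step of the
  arithmetic-geometric mean.
\<close>
lemma theta3_square:
  assumes "Re w < 0"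
  shows "(theta3 w)\<^sup>2 = (theta3 (2 * w))\<^sup>2 + (theta2 (2 * w))\<^sup>2"
proof -
  have "exp w = exp (2 * w / 4) * exp (2 * w / 4)"
    by (simp flip: exp_add)
  then show ?thesis
    using theta_mult[OF assms, of 0 0]
    by (simp add: theta3_def theta2_def power2_eq_square)
qed

lemma theta4_square:
  assumes "Re w < 0"
  shows "(theta4 w)\<^sup>2 = (theta3 (2 * w))\<^sup>2 - (theta2 (2 * w))\<^sup>2"
proof -
  have "exp (of_real pi * \<i> + w) = - (exp (2 * w / 4) * exp (2 * w / 4))"
    by (simp add: exp_add flip: exp_add[of "w / 2"])
  moreover have "theta (of_real pi * \<i> + of_real pi * \<i>) (2 * w) = theta 0 (2 * w)"
    using theta_periodic[of 0 "2 * w"] by (simp add: mult_ac)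
  moreover have "theta (of_real pi * \<i> + of_real pi * \<i> + 2 * w) (2 * w) = theta (2 * w) (2 * w)"
    using theta_periodic[of "2 * w" "2 * w"] by (simp add: algebra_simps)
  ultimately show ?thesis
    using theta_mult[OF assms, of "of_real pi * \<i>" "of_real pi * \<i>"]
    by (simp add: theta4_def theta3_def theta2_def power2_eq_square)
qed

lemma theta3_mult_theta4:
  assumes "Re w < 0"
  shows "theta3 w * theta4 w = (theta4 (2 * w))\<^sup>2"
  using theta_mult[OF assms, of 0 "of_real pi * \<i>"] theta_pi_shift_zero[of "2 * w"]
  by (simp add: theta3_def theta4_def theta_minus power2_eq_square)

lemma theta2_square:
  assumes "Re w < 0"
  shows "(theta2 w)\<^sup>2 = 2 * theta2 (2 * w) * theta3 (2 * w)"
proof -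
  have "theta (w + w + 2 * w) (2 * w) = exp (- (2 * w)) * theta 0 (2 * w)"
    using theta_shift[of 0 "2 * w"] by simp
  moreover have "exp (w + w) * (exp (- (2 * w)) * z) = z" for z
    by (simp flip: exp_add mult.assoc)
  ultimately have "theta w w * theta w w = 2 * theta (2 * w) (2 * w) * theta 0 (2 * w)"
    using theta_mult[OF assms, of w w] by (simp add: mult_ac mult_2[of w, symmetric])
  moreover have "exp (w / 4) * exp (w / 4) = exp (2 * w / 4)"
    by (simp flip: exp_add)
  moreover have "(theta2 w)\<^sup>2 = (exp (w / 4) * exp (w / 4)) * (theta w w * theta w w)"
    by (simp add: theta2_def power2_eq_square mult_ac)
  ultimately show ?thesis
    by (simp add: theta2_def theta3_def)
qed

lemma jacobi_quartic:
  assumes "Re w < 0"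
  shows "theta3 w ^ 4 = theta2 w ^ 4 + theta4 w ^ 4"
proof -
  have "theta2 w ^ 4 = ((theta2 w)\<^sup>2)\<^sup>2" "theta3 w ^ 4 = ((theta3 w)\<^sup>2)\<^sup>2" "theta4 w ^ 4 = ((theta4 w)\<^sup>2)\<^sup>2"
    by (simp_all flip: power_mult)
  then show ?thesis
    unfolding theta2_square[OF assms] theta3_square[OF assms] theta4_square[OF assms]
    by (simp only:) (simp add: power2_eq_square algebra_simps)
qed

lemma exp_sq_less_1: "Re w < 0 \<Longrightarrow> norm ((exp w)\<^sup>2) < 1"
  by (simp add: norm_power power_less_one_iff)

lemma theta3_product:
  assumes "Re w < 0"
  shows "theta3 w = qprod (- ((exp w)\<^sup>2)) ((exp w)\<^sup>2) * (qprod (exp w) ((exp w)\<^sup>2))\<^sup>2"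
  using jacobi_triple_product[OF assms, of 0] by (simp add: theta3_def power2_eq_square)

lemma theta4_product:
  assumes "Re w < 0"
  shows "theta4 w = qprod (- ((exp w)\<^sup>2)) ((exp w)\<^sup>2) * (qprod (- exp w) ((exp w)\<^sup>2))\<^sup>2"
  using jacobi_triple_product[OF assms, of "of_real pi * \<i>"]
  by (simp add: theta4_def power2_eq_square exp_minus)

lemma theta2_product:
  assumes "Re w < 0"
  shows "theta2 w = 2 * exp (w / 4) * qprod (- ((exp w)\<^sup>2)) ((exp w)\<^sup>2) * (qprod ((exp w)\<^sup>2) ((exp w)\<^sup>2))\<^sup>2"
proof -
  have "qprod (exp (- w) * exp w) ((exp w)\<^sup>2) = 2 * qprod ((exp w)\<^sup>2) ((exp w)\<^sup>2)"
    using qprod_step[OF exp_sq_less_1[OF assms], of 1] by (simp flip: exp_add)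
  then show ?thesis
    using jacobi_triple_product[OF assms, of w] by (simp add: theta2_def power2_eq_square)
qed

lemma theta_const_nonzero:
  assumes "Re w < 0"
  shows "theta2 w \<noteq> 0" "theta3 w \<noteq> 0" "theta4 w \<noteq> 0"
  unfolding theta2_product[OF assms] theta3_product[OF assms] theta4_product[OF assms]
  using assms exp_sq_less_1[OF assms] by (simp_all add: qprod_nonzero)

text \<open>
  Euler's identity \<open>(-q; q)_\<infinity> (q; q^2)_\<infinity> = 1\<close>.
\<close>
lemma euler_odd_even:
  assumes "norm q < 1"
  shows "qprod q q * qprod (- q) (q\<^sup>2) = 1"
proof -
  have q2: "norm (q\<^sup>2) < 1" using assms by (simp add: norm_power power_less_one_iff abs_square_less_1)
  have "qprod q q * (qprod (- q) (q\<^sup>2) * qprod (- (q\<^sup>2)) (q\<^sup>2)) = qprod q q * qprod (- q) q"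
    using qprod_split[OF assms, of "- q"] by (simp add: power2_eq_square)
  also have "\<dots> = qprod (- (q\<^sup>2)) (q\<^sup>2)"
    by (rule qprod_mult_minus[OF assms])
  finally have "(qprod q q * qprod (- q) (q\<^sup>2)) * qprod (- (q\<^sup>2)) (q\<^sup>2) = 1 * qprod (- (q\<^sup>2)) (q\<^sup>2)"
    by (simp add: mult.assoc)
  moreover have "qprod (- (q\<^sup>2)) (q\<^sup>2) \<noteq> 0"
    using q2 by (intro qprod_nonzero) auto
  ultimately show ?thesis by (metis mult_right_cancel)
qed

text \<open>
  In terms of the moduli this is the class invariant relation \<open>2 k / k'^2 = 8 q^(1/2) phi(-q)^12\<close>,
  a quadratic equation for \<open>k\<close> whose solution is the defining formula of \<open>k11\<close>.
\<close>
lemma theta_phi_neg: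
  assumes "Re w < 0"
  shows "theta2 w * theta3 w = 2 * exp (w / 4) * phi_neg (exp w) ^ 6 * (theta4 w)\<^sup>2"
proof -
  define q where "q = exp w"
  have q: "norm q < 1" using assms by (simp add: q_def)
  define p where "p = qprod (- (q\<^sup>2)) (q\<^sup>2)"
  define x where "x = qprod q (q\<^sup>2)"
  define y where "y = qprod (- q) (q\<^sup>2)"
  define z where "z = qprod (q\<^sup>2) (q\<^sup>2)"
  have phi: "phi_neg q = qprod q q"
    by (simp add: phi_neg_def qprod_def)
  have xz: "phi_neg q = x * z"
    using qprod_split[OF q, of q] by (simp add: phi x_def z_def power2_eq_square)
  have y: "phi_neg q * y = 1"
    using euler_odd_even[OF q] by (simp add: phi y_def)
  have "2 * exp (w / 4) * phi_neg q ^ 6 * (p * y\<^sup>2)\<^sup>2 = 2 * exp (w / 4) * (phi_neg q)\<^sup>2 * p\<^sup>2 * (phi_neg q * y) ^ 4"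
    by (simp add: power_mult_distrib power_add[symmetric] power_mult[symmetric] mult_ac numeral_eq_Suc)
  also have "\<dots> = (2 * exp (w / 4) * p * z\<^sup>2) * (p * x\<^sup>2)"
    unfolding y unfolding xz by (simp add: power2_eq_square)
  finally show ?thesis
    unfolding theta2_product[OF assms] theta3_product[OF assms] theta4_product[OF assms] q_def[symmetric]
    by (simp add: p_def x_def y_def z_def)
qed

lemma theta_const_holomorphic:
  "theta2 holomorphic_on {w. Re w < 0}" "theta3 holomorphic_on {w. Re w < 0}" "theta4 holomorphic_on {w. Re w < 0}"
  unfolding theta2_def[abs_def] theta3_def[abs_def] theta4_def[abs_def]
  by (intro holomorphic_intros theta_holomorphic; simp)+

lemma theta_const_real_pos:
  assumes "x < 0"
  obtains s t u :: real where "s > 0" "t > 0" "u > 0"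
    "theta2 (of_real x) = of_real s" "theta3 (of_real x) = of_real t" "theta4 (of_real x) = of_real u"
proof -
  define q where "q = exp x"
  have q: "0 < q" "q < 1" using assms by (auto simp: q_def)
  then have q2: "0 \<le> q\<^sup>2" "q\<^sup>2 < 1" by (auto simp: power_less_one_iff abs_square_less_1)
  have ex: "exp (complex_of_real x) = of_real q" "exp (complex_of_real x / 4) = of_real (exp (x / 4))"
    by (simp add: q_def exp_of_real) (metis exp_of_real of_real_divide of_real_numeral)
  obtain a where a: "a > 0" "qprod (- ((of_real q)\<^sup>2)) ((of_real q)\<^sup>2) = of_real a"
    using qprod_real_pos[OF q2, of "- (q\<^sup>2)"] q2 by auto
  obtain b where b: "b > 0" "qprod (of_real q) ((of_real q)\<^sup>2) = of_real b"
    using qprod_real_pos[OF q2, of q] q by auto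
  obtain c where c: "c > 0" "qprod (- of_real q) ((of_real q)\<^sup>2) = of_real c"
    using qprod_real_pos[OF q2, of "- q"] q by auto
  obtain d where d: "d > 0" "qprod ((of_real q)\<^sup>2) ((of_real q)\<^sup>2) = of_real d"
    using qprod_real_pos[OF q2, of "q\<^sup>2"] q2 by auto
  have x: "Re (complex_of_real x) < 0" using assms by simp
  show ?thesis
  proof
    show "theta2 (of_real x) = of_real (2 * exp (x / 4) * a * d\<^sup>2)"
      unfolding theta2_product[OF x] ex a d by simp
    show "theta3 (of_real x) = of_real (a * b\<^sup>2)"
      unfolding theta3_product[OF x] ex a b by simp
    show "theta4 (of_real x) = of_real (a * c\<^sup>2)"
      unfolding theta4_product[OF x] ex a c by simp
  qed (use a b c d in auto)
qed

lemma theta_LIMSEQ_1: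
  assumes "Re u = 0" "x < 0"
  shows "(\<lambda>n. theta u (of_real (2 ^ n * x))) \<longlonglongrightarrow> 1"
proof -
  define l :: "int \<Rightarrow> complex" where "l k = (if k = 0 then 1 else 0)" for k
  have neg: "2 ^ n * x \<le> x" for n :: nat
    using assms by simp
  have bound: "norm (theta_term u (of_real (2 ^ n * x)) k) \<le> gauss_bound 0 (- x) k" for n k
    using assms neg[of n] by (intro norm_theta_term_le) auto
  have lim: "(\<lambda>n. theta_term u (of_real (2 ^ n * x)) k) \<longlonglongrightarrow> l k" for k
  proof (cases "k = 0")
    case False
    have "x * (of_int k)\<^sup>2 < 0"
      using False assms by (simp add: mult_neg_pos)
    then have "(\<lambda>m. exp (x * (of_int k)\<^sup>2) ^ m) \<longlonglongrightarrow> 0"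
      by (intro LIMSEQ_realpow_zero) auto
    then have "(\<lambda>n. exp (x * (of_int k)\<^sup>2) ^ (2 ^ n)) \<longlonglongrightarrow> 0"
      by (rule LIMSEQ_subseq_LIMSEQ[unfolded o_def]) (simp add: strict_mono_def)
    moreover have "norm (theta_term u (of_real (2 ^ n * x)) k) = exp (x * (of_int k)\<^sup>2) ^ (2 ^ n)" for n
    proof -
      have "u * of_int k + of_real (2 ^ n * x) * (of_int k)\<^sup>2 = u * of_real (of_int k) + of_real (2 ^ n * x * (of_int k)\<^sup>2)"
        by simp
      then have "Re (u * of_int k + of_real (2 ^ n * x) * (of_int k)\<^sup>2) = of_nat (2 ^ n) * (x * (of_int k)\<^sup>2)"
        using assms(1) by (simp only: plus_complex.sel Re_complex_of_real times_complex.sel Im_complex_of_real) simp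
      then show ?thesis
        unfolding theta_term_def norm_exp_eq_Re by (simp only: exp_of_nat_mult)
    qed
    ultimately have "(\<lambda>n. norm (theta_term u (of_real (2 ^ n * x)) k)) \<longlonglongrightarrow> 0"
      by simp
    then show ?thesis
      using False by (simp add: l_def tendsto_norm_zero_iff del: of_real_mult of_real_power)
  qed (simp add: theta_term_def l_def)
  show ?thesis
  proof (rule swap_uniform_limit'[where F = "finite_subsets_at_top UNIV"])
    show "\<forall>\<^sub>F X in finite_subsets_at_top UNIV. (\<lambda>n. \<Sum>k\<in>X. theta_term u (of_real (2 ^ n * x)) k) \<longlonglongrightarrow> (\<Sum>k\<in>X. l k)"
      by (intro always_eventually allI tendsto_sum lim)
    have "(l has_sum 1) UNIV"
      by (rule has_sum_finite_neutralI[of "{0}"]) (auto simp: l_def)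
    then show "((\<lambda>X. \<Sum>k\<in>X. l k) \<longlongrightarrow> 1) (finite_subsets_at_top UNIV)"
      by (simp add: has_sum_def)
    show "uniform_limit UNIV (\<lambda>X n. \<Sum>k\<in>X. theta_term u (of_real (2 ^ n * x)) k)
        (\<lambda>n. theta u (of_real (2 ^ n * x))) (finite_subsets_at_top UNIV)"
      unfolding theta_def by (rule Weierstrass_m_test_general[OF bound gauss_bound_summable])
  qed auto
qed

section \<open>The complete elliptic integral\<close>

definition gauss_integral :: "real \<Rightarrow> real \<Rightarrow> real" where
  "gauss_integral a b = integral {0..pi/2} (\<lambda>t. 1 / sqrt (a\<^sup>2 * (cos t)\<^sup>2 + b\<^sup>2 * (sin t)\<^sup>2))"

lemma cos_sin_quadratic_pos:
  fixes a b t :: real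
  assumes "a > 0" "b > 0"
  shows "a * (cos t)\<^sup>2 + b * (sin t)\<^sup>2 > 0"
proof -
  have "min a b * ((sin t)\<^sup>2 + (cos t)\<^sup>2) \<le> a * (cos t)\<^sup>2 + b * (sin t)\<^sup>2"
    unfolding distrib_left by (simp add: add.commute add_mono mult_right_mono)
  moreover have "min a b > 0" using assms by simp
  ultimately show ?thesis by (simp only: sin_cos_squared_add mult_1_right)
qed

lemma gauss_integrand_continuous:
  fixes a b :: real
  assumes "a > 0" "b > 0"
  shows "continuous_on S (\<lambda>t. 1 / sqrt (a\<^sup>2 * (cos t)\<^sup>2 + b\<^sup>2 * (sin t)\<^sup>2))"
proof -
  have "a\<^sup>2 * (cos t)\<^sup>2 + b\<^sup>2 * (sin t)\<^sup>2 > 0" for t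
    using assms by (intro cos_sin_quadratic_pos) auto
  then have "sqrt (a\<^sup>2 * (cos t)\<^sup>2 + b\<^sup>2 * (sin t)\<^sup>2) \<noteq> 0" for t
    by (metis less_numeral_extra(3) real_sqrt_eq_zero_cancel_iff)
  then show ?thesis by (intro continuous_intros) auto
qed

lemma gauss_integral_bounds:
  assumes "0 < m" "m \<le> a" "m \<le> b" "a \<le> M" "b \<le> M"
  shows "pi / (2 * M) \<le> gauss_integral a b" "gauss_integral a b \<le> pi / (2 * m)"
proof -
  let ?D = "\<lambda>t. a\<^sup>2 * (cos t)\<^sup>2 + b\<^sup>2 * (sin t)\<^sup>2"
  have int: "(\<lambda>t. 1 / sqrt (?D t)) integrable_on {0..pi/2}"
    using assms by (intro integrable_continuous_interval gauss_integrand_continuous) auto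
  have lo: "m \<le> sqrt (?D t)" and hi: "sqrt (?D t) \<le> M" for t
  proof -
    have "m\<^sup>2 * (cos t)\<^sup>2 + m\<^sup>2 * (sin t)\<^sup>2 \<le> ?D t" "?D t \<le> M\<^sup>2 * (cos t)\<^sup>2 + M\<^sup>2 * (sin t)\<^sup>2"
      using assms by (intro add_mono mult_right_mono power_mono; simp)+
    then have "m\<^sup>2 \<le> ?D t" "?D t \<le> M\<^sup>2"
      by (simp_all flip: distrib_left)
    then show "m \<le> sqrt (?D t)" "sqrt (?D t) \<le> M"
      using assms by (auto intro: real_le_rsqrt real_le_lsqrt)
  qed
  have pos: "sqrt (?D t) > 0" for t
    using lo[of t] assms(1) by (rule less_le_trans[rotated])
  have "integral {0..pi/2} (\<lambda>t. 1 / M) \<le> gauss_integral a b"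
    unfolding gauss_integral_def
    using hi assms pos by (intro integral_le int integrable_const_ivl frac_le) simp_all
  then show "pi / (2 * M) \<le> gauss_integral a b" by simp
  have "gauss_integral a b \<le> integral {0..pi/2} (\<lambda>t. 1 / m)"
    unfolding gauss_integral_def
    using lo assms by (intro integral_le int integrable_const_ivl frac_le) simp_all
  then show "gauss_integral a b \<le> pi / (2 * m)" by simp
qed

lemma gauss_integral_limit:
  fixes a b :: "nat \<Rightarrow> real"
  assumes pos: "\<And>n. a n > 0" "\<And>n. b n > 0"
    and lim: "a \<longlonglongrightarrow> 1" "b \<longlonglongrightarrow> 1"
  shows "(\<lambda>n. gauss_integral (a n) (b n)) \<longlonglongrightarrow> pi / 2"
proof (rule tendsto_sandwich)
  show "\<forall>\<^sub>F n in sequentially. pi / (2 * max (a n) (b n)) \<le> gauss_integral (a n) (b n)"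
    using pos gauss_integral_bounds(1)[of "min (a n) (b n)" "a n" "b n" "max (a n) (b n)" for n]
    by (intro always_eventually allI) (simp add: less_max_iff_disj)
  show "\<forall>\<^sub>F n in sequentially. gauss_integral (a n) (b n) \<le> pi / (2 * min (a n) (b n))"
    using pos gauss_integral_bounds(2)[of "min (a n) (b n)" "a n" "b n" "max (a n) (b n)" for n]
    by (intro always_eventually allI) (simp add: less_max_iff_disj)
  have "(\<lambda>n. pi / (2 * max (a n) (b n))) \<longlonglongrightarrow> pi / (2 * max 1 1)"
    by (intro tendsto_intros tendsto_max lim) auto
  then show "(\<lambda>n. pi / (2 * max (a n) (b n))) \<longlonglongrightarrow> pi / 2" by simp
  have "(\<lambda>n. pi / (2 * min (a n) (b n))) \<longlonglongrightarrow> pi / (2 * min 1 1)"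
    by (intro tendsto_intros tendsto_min lim) auto
  then show "(\<lambda>n. pi / (2 * min (a n) (b n))) \<longlonglongrightarrow> pi / 2" by simp
qed

text \<open>
  Landen's substitution.  The new angle is \<open>t + s\<close> with \<open>tan s = (b / a) tan t\<close>; it runs from \<open>0\<close>
  to \<open>pi\<close> while \<open>t\<close> runs from \<open>0\<close> to \<open>pi / 2\<close>, and the integrand over the second quarter turn
  mirrors that over the first.
\<close>
lemma gauss_integral_landen:
  assumes a: "a > 0" and b: "b > 0"
  shows "gauss_integral a b = gauss_integral ((a + b) / 2) (sqrt (a * b))"
proof -
  define D E :: "real \<Rightarrow> real" where "D t = sqrt (a\<^sup>2 * (cos t)\<^sup>2 + b\<^sup>2 * (sin t)\<^sup>2)"
    and "E t = a * (cos t)\<^sup>2 + b * (sin t)\<^sup>2" for t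
  have D: "D t > 0" "(D t)\<^sup>2 = a\<^sup>2 * (cos t)\<^sup>2 + b\<^sup>2 * (sin t)\<^sup>2" for t
    unfolding D_def using cos_sin_quadratic_pos[of "a\<^sup>2" "b\<^sup>2" t] a b by simp_all
  have E: "E t > 0" for t
    unfolding E_def by (rule cos_sin_quadratic_pos[OF a b])
  define r where "r t = (b - a) * (sin t * cos t) / E t" for t
  \<comment> \<open>\<open>s - t\<close> is written as a single arctangent, which is smooth also at \<open>t = pi / 2\<close>, where \<open>tan t\<close> has a pole\<close>
  define P where "P t = 2 * t + arctan (r t)" for t
  define F where "F t = 1 / sqrt (((a + b) / 2)\<^sup>2 * (cos t)\<^sup>2 + (sqrt (a * b))\<^sup>2 * (sin t)\<^sup>2)" for t
  have DE: "(D t)\<^sup>2 = (E t)\<^sup>2 + ((b - a) * (sin t * cos t))\<^sup>2" for t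
  proof -
    have "(E t)\<^sup>2 + ((b - a) * (sin t * cos t))\<^sup>2 = (a\<^sup>2 * (cos t)\<^sup>2 + b\<^sup>2 * (sin t)\<^sup>2) * ((sin t)\<^sup>2 + (cos t)\<^sup>2)"
      unfolding E_def by algebra
    then show ?thesis by (simp add: D)
  qed
  have DE': "(D t)\<^sup>2 + a * b = (a + b) * E t" for t
  proof -
    have "a\<^sup>2 * (cos t)\<^sup>2 + b\<^sup>2 * (sin t)\<^sup>2 + a * b * ((sin t)\<^sup>2 + (cos t)\<^sup>2) = (a + b) * E t"
      unfolding E_def by algebra
    then show ?thesis by (simp add: D)
  qed
  have sq1: "1 + (r t)\<^sup>2 = (D t / E t)\<^sup>2" for t
    using E[of t] DE[of t] by (simp add: r_def power_divide field_simps)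
  have sq1': "sqrt (1 + (r t)\<^sup>2) = D t / E t" for t
    unfolding sq1 using E[of t] D(1)[of t] by simp
  have cosP: "cos (P t) = (a * (cos t)\<^sup>2 - b * (sin t)\<^sup>2) / D t" for t
  proof -
    have "cos (P t) = ((cos t)\<^sup>2 - (sin t)\<^sup>2) * (E t / D t) - (2 * sin t * cos t) * (r t * (E t / D t))"
      unfolding P_def cos_add cos_double sin_double cos_arctan sin_arctan sq1' by simp
    also have "\<dots> = (((cos t)\<^sup>2 - (sin t)\<^sup>2) * E t - 2 * sin t * cos t * ((b - a) * (sin t * cos t))) / D t"
      using E[of t] by (simp add: r_def diff_divide_distrib)
    also have "((cos t)\<^sup>2 - (sin t)\<^sup>2) * E t - 2 * sin t * cos t * ((b - a) * (sin t * cos t)) =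
        (a * (cos t)\<^sup>2 - b * (sin t)\<^sup>2) * ((sin t)\<^sup>2 + (cos t)\<^sup>2)"
      unfolding E_def by algebra
    finally show ?thesis by simp
  qed
  have sinP: "sin (P t) = (a + b) * (sin t * cos t) / D t" for t
  proof -
    have "sin (P t) = (2 * sin t * cos t) * (E t / D t) + ((cos t)\<^sup>2 - (sin t)\<^sup>2) * (r t * (E t / D t))"
      unfolding P_def sin_add cos_double sin_double cos_arctan sin_arctan sq1' by simp
    also have "\<dots> = (2 * sin t * cos t * E t + ((cos t)\<^sup>2 - (sin t)\<^sup>2) * ((b - a) * (sin t * cos t))) / D t"
      using E[of t] by (simp add: r_def add_divide_distrib)
    also have "2 * sin t * cos t * E t + ((cos t)\<^sup>2 - (sin t)\<^sup>2) * ((b - a) * (sin t * cos t)) =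
        (a + b) * (sin t * cos t) * ((sin t)\<^sup>2 + (cos t)\<^sup>2)"
      unfolding E_def by algebra
    finally show ?thesis by simp
  qed
  have FP: "F (P t) = 2 * D t / ((a + b) * E t)" for t
  proof -
    have "((a + b) / 2)\<^sup>2 * (cos (P t))\<^sup>2 + (sqrt (a * b))\<^sup>2 * (sin (P t))\<^sup>2 =
       (((a + b) / 2)\<^sup>2 * (a * (cos t)\<^sup>2 - b * (sin t)\<^sup>2)\<^sup>2 + a * b * ((a + b) * (sin t * cos t))\<^sup>2) / (D t)\<^sup>2"
      using a b unfolding cosP sinP by (simp add: power_divide add_divide_distrib)
    also have "((a + b) / 2)\<^sup>2 * (a * (cos t)\<^sup>2 - b * (sin t)\<^sup>2)\<^sup>2 + a * b * ((a + b) * (sin t * cos t))\<^sup>2 =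
       ((a + b) * E t / 2)\<^sup>2"
      unfolding E_def by (simp add: power2_eq_square field_simps)
    finally have "((a + b) / 2)\<^sup>2 * (cos (P t))\<^sup>2 + (sqrt (a * b))\<^sup>2 * (sin (P t))\<^sup>2 = ((a + b) * E t / (2 * D t))\<^sup>2"
      by (simp add: power_divide power_mult_distrib)
    moreover have "(a + b) * E t > 0" "2 * D t > 0"
      using a b E[of t] D(1)[of t] by simp_all
    ultimately show ?thesis unfolding F_def by (simp only: real_sqrt_abs abs_divide abs_of_pos) simp
  qed
  have dP: "(P has_field_derivative (1 + a * b / (D t)\<^sup>2)) (at t within S)" for t S
  proof -
    define dr where "dr = (b - a) * (a * (cos t)\<^sup>2 - b * (sin t)\<^sup>2) / (E t)\<^sup>2"
    have "(E has_field_derivative 2 * (b - a) * (sin t * cos t)) (at t within S)"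
      unfolding E_def[abs_def] by (auto intro!: derivative_eq_intros simp: algebra_simps)
    then have "(r has_field_derivative (((b - a) * ((cos t)\<^sup>2 - (sin t)\<^sup>2)) * E t - (b - a) * (sin t * cos t) * (2 * (b - a) * (sin t * cos t))) / (E t * E t)) (at t within S)"
      unfolding r_def[abs_def] using E[of t]
      by (auto intro!: derivative_eq_intros simp: power2_eq_square)
    also have "((b - a) * ((cos t)\<^sup>2 - (sin t)\<^sup>2)) * E t - (b - a) * (sin t * cos t) * (2 * (b - a) * (sin t * cos t)) =
       (b - a) * (a * (cos t)\<^sup>2 - b * (sin t)\<^sup>2) * ((sin t)\<^sup>2 + (cos t)\<^sup>2)"
      unfolding E_def by algebra
    finally have dr: "(r has_field_derivative dr) (at t within S)"
      unfolding dr_def sin_cos_squared_add mult_1_right power2_eq_square[of "E t"] .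
    have "(P has_field_derivative (2 + inverse (1 + (r t)\<^sup>2) * dr)) (at t within S)"
      unfolding P_def[abs_def] by (auto intro!: derivative_eq_intros dr simp: field_simps)
    also have "2 + inverse (1 + (r t)\<^sup>2) * dr = 2 + (b - a) * (a * (cos t)\<^sup>2 - b * (sin t)\<^sup>2) / (D t)\<^sup>2"
      unfolding sq1 dr_def using E[of t] D(1)[of t] by (simp add: power_divide)
    also have "\<dots> = (2 * (D t)\<^sup>2 + (b - a) * (a * (cos t)\<^sup>2 - b * (sin t)\<^sup>2)) / (D t)\<^sup>2"
      using D(1)[of t] by (simp add: add_divide_distrib)
    also have "2 * (D t)\<^sup>2 + (b - a) * (a * (cos t)\<^sup>2 - b * (sin t)\<^sup>2) = (D t)\<^sup>2 + a * b * ((sin t)\<^sup>2 + (cos t)\<^sup>2)"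
      unfolding D by algebra
    finally show ?thesis using D(1)[of t] by (simp add: add_divide_distrib)
  qed
  have F_cont: "continuous_on S F" for S
    unfolding F_def using a b by (intro gauss_integrand_continuous) auto
  have P_range: "P ` {0..pi/2} \<subseteq> {- pi / 2..3 * pi / 2}"
  proof -
    have "- pi / 2 \<le> P t \<and> P t \<le> 3 * pi / 2" if "t \<in> {0..pi/2}" for t
      using that arctan_bounded[of "r t"] by (auto simp: P_def)
    then show ?thesis by auto
  qed
  have "((\<lambda>t. (1 + a * b / (D t)\<^sup>2) *\<^sub>R F (P t)) has_integral integral {P 0..P (pi/2)} F) {0..pi/2}"
    by (rule has_integral_substitution[OF _ _ P_range F_cont dP]) (auto simp: P_def r_def)
  moreover have "P 0 = 0" "P (pi/2) = pi" by (auto simp: P_def r_def)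
  moreover have "(1 + a * b / (D t)\<^sup>2) *\<^sub>R F (P t) = 2 * (1 / D t)" for t
  proof -
    have "1 + a * b / (D t)\<^sup>2 = (a + b) * E t / (D t)\<^sup>2"
      using D(1)[of t] by (simp add: DE'[symmetric] add_divide_distrib)
    then show ?thesis
      unfolding FP using D(1)[of t] E[of t] a b by (simp add: power2_eq_square)
  qed
  ultimately have "((\<lambda>t. 2 * (1 / D t)) has_integral integral {0..pi} F) {0..pi/2}"
    by simp
  moreover have "((\<lambda>t. 2 * (1 / D t)) has_integral 2 * gauss_integral a b) {0..pi/2}"
    unfolding gauss_integral_def D_def
    by (intro has_integral_mult_right integrable_integral integrable_continuous_interval gauss_integrand_continuous a b)
  ultimately have 1: "2 * gauss_integral a b = integral {0..pi} F"
    using has_integral_unique by blast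
  have F_int: "F integrable_on {0..pi}"
    by (rule integrable_continuous_interval[OF F_cont])
  have half: "integral {0..pi/2} F = gauss_integral ((a + b) / 2) (sqrt (a * b))"
    by (simp add: gauss_integral_def F_def[abs_def])
  have "((\<lambda>t. - 1 *\<^sub>R F (pi - t)) has_integral
       (integral {pi - 0..pi - pi/2} F - integral {pi - pi/2..pi - 0} F)) {0..pi/2}"
    by (rule has_integral_substitution_general[of "{}" _ _ "\<lambda>t. pi - t" "pi/2" pi F "\<lambda>_. - 1"])
       (auto intro!: F_cont continuous_intros derivative_eq_intros)
  moreover have "F (pi - t) = F t" for t by (simp add: F_def)
  ultimately have "((\<lambda>t. - F t) has_integral - integral {pi/2..pi} F) {0..pi/2}"
    by (simp add: field_simps)
  then have "integral {pi/2..pi} F = integral {0..pi/2} F"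
    by (metis add.inverse_inverse has_integral_integrable_integral has_integral_neg_iff integral_unique)
  then have "integral {0..pi} F = 2 * integral {0..pi/2} F"
    using Henstock_Kurzweil_Integration.integral_combine[of 0 "pi/2" pi F] F_int by simp
  with 1 half show ?thesis by simp
qed

text \<open>
  Replacing \<open>w\<close> by \<open>2 w\<close> leaves the integral unchanged by Landen's transformation, while both theta
  constants tend to one along \<open>2^n x\<close>.
\<close>
lemma gauss_integral_theta:
  assumes x: "x < 0" and t: "t > 0" "theta3 (of_real x) = of_real t" and u: "u > 0" "theta4 (of_real x) = of_real u"
  shows "gauss_integral (t\<^sup>2) (u\<^sup>2) = pi / 2"
proof -
  define T U :: "nat \<Rightarrow> real" where "T n = Re (theta3 (of_real (2 ^ n * x)))"
    and "U n = Re (theta4 (of_real (2 ^ n * x)))" for n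
  have xn: "2 ^ n * x < 0" for n :: nat using x by (simp add: mult_pos_neg)
  have TU: "theta3 (of_real (2 ^ n * x)) = of_real (T n)" "theta4 (of_real (2 ^ n * x)) = of_real (U n)"
    "T n > 0" "U n > 0" for n
    by (rule theta_const_real_pos[OF xn[of n]], simp add: T_def U_def)+
  have step: "gauss_integral ((T n)\<^sup>2) ((U n)\<^sup>2) = gauss_integral ((T (Suc n))\<^sup>2) ((U (Suc n))\<^sup>2)" for n
  proof -
    define w where "w = complex_of_real (2 ^ n * x)"
    have w: "Re w < 0" "2 * w = of_real (2 ^ Suc n * x)"
      using xn[of n] by (simp_all add: w_def)
    have "(theta3 w)\<^sup>2 + (theta4 w)\<^sup>2 = 2 * (theta3 (2 * w))\<^sup>2"
      by (simp add: theta3_square[OF w(1)] theta4_square[OF w(1)])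
    then have "complex_of_real ((T n)\<^sup>2 + (U n)\<^sup>2) = of_real (2 * (T (Suc n))\<^sup>2)"
      unfolding w(2) unfolding w_def TU by simp
    then have 1: "((T n)\<^sup>2 + (U n)\<^sup>2) / 2 = (T (Suc n))\<^sup>2"
      unfolding of_real_eq_iff by simp
    have "complex_of_real (T n * U n) = of_real ((U (Suc n))\<^sup>2)"
      using theta3_mult_theta4[OF w(1)] unfolding w(2) unfolding w_def TU by simp
    then have "T n * U n = (U (Suc n))\<^sup>2"
      unfolding of_real_eq_iff .
    then have 2: "sqrt ((T n)\<^sup>2 * (U n)\<^sup>2) = (U (Suc n))\<^sup>2"
      using TU(3,4)[of n] by (simp add: real_sqrt_mult)
    show ?thesis
      using gauss_integral_landen[of "(T n)\<^sup>2" "(U n)\<^sup>2"] TU(3,4)[of n] unfolding 1 2 by simp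
  qed
  have const: "gauss_integral ((T n)\<^sup>2) ((U n)\<^sup>2) = gauss_integral ((T 0)\<^sup>2) ((U 0)\<^sup>2)" for n
    by (induction n) (simp_all flip: step)
  have "T \<longlonglongrightarrow> Re 1" "U \<longlonglongrightarrow> Re 1"
    unfolding T_def U_def theta3_def theta4_def
    by (rule tendsto_Re[OF theta_LIMSEQ_1[OF _ x]]; simp)+
  then have "(\<lambda>n. (T n)\<^sup>2) \<longlonglongrightarrow> (Re 1)\<^sup>2" "(\<lambda>n. (U n)\<^sup>2) \<longlonglongrightarrow> (Re 1)\<^sup>2"
    by (blast intro: tendsto_power)+
  then have "(\<lambda>n. gauss_integral ((T n)\<^sup>2) ((U n)\<^sup>2)) \<longlonglongrightarrow> pi / 2"
    using TU(3,4)[THEN less_imp_neq, THEN not_sym] by (intro gauss_integral_limit) simp_all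
  then have "(\<lambda>n::nat. gauss_integral ((T 0)\<^sup>2) ((U 0)\<^sup>2)) \<longlonglongrightarrow> pi / 2"
    by (rule Lim_transform_eventually) (rule always_eventually, rule allI, rule const)
  then have "gauss_integral ((T 0)\<^sup>2) ((U 0)\<^sup>2) = pi / 2"
    by (simp only: LIMSEQ_const_iff)
  moreover have "T 0 = t" "U 0 = u" using t u by (simp_all add: T_def U_def)
  ultimately show ?thesis by simp
qed

text \<open>
  Jacobi's evaluation of \<open>K\<close>, the radicand being
  \<open>(theta3^4 cos^2 + theta4^4 sin^2) / theta3^4\<close> by the quartic identity.
\<close>
lemma ellK_theta:
  assumes x: "x < 0" and w: "w = complex_of_real x"
  shows "ellK ((theta2 w / theta3 w)\<^sup>2) = of_real (pi / 2) * (theta3 w)\<^sup>2"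
proof -
  obtain s t u :: real where stu: "s > 0" "t > 0" "u > 0"
    and th: "theta2 w = of_real s" "theta3 w = of_real t" "theta4 w = of_real u"
    using theta_const_real_pos[OF x] unfolding w by metis
  have "Re w < 0" using x w by simp
  then have "complex_of_real (t ^ 4) = of_real (s ^ 4 + u ^ 4)"
    using jacobi_quartic[of w] by (simp add: th)
  then have quartic: "t ^ 4 = s ^ 4 + u ^ 4"
    unfolding of_real_eq_iff .
  let ?D = "\<lambda>y. sqrt ((t\<^sup>2)\<^sup>2 * (cos y)\<^sup>2 + (u\<^sup>2)\<^sup>2 * (sin y)\<^sup>2)"
  have integrand: "1 / csqrt (1 - ((theta2 w / theta3 w)\<^sup>2)\<^sup>2 * (of_real (sin y))\<^sup>2) = of_real (t\<^sup>2 * (1 / ?D y))" for y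
  proof -
    have "1 - ((s / t)\<^sup>2)\<^sup>2 * (sin y)\<^sup>2 = ((t\<^sup>2)\<^sup>2 * (cos y)\<^sup>2 + (u\<^sup>2)\<^sup>2 * (sin y)\<^sup>2) / (t\<^sup>2)\<^sup>2"
    proof -
      have u: "(u\<^sup>2)\<^sup>2 = (t\<^sup>2)\<^sup>2 - (s\<^sup>2)\<^sup>2" using quartic by (simp flip: power_mult)
      have "1 - B / A * z = (A * (1 - z) + (A - B) * z) / A" if "A \<noteq> 0" for A B z :: real
        using that by (simp add: field_simps)
      then show ?thesis
        unfolding cos_squared_eq power_divide u using stu by simp
    qed
    also have "\<dots> = (?D y / t\<^sup>2)\<^sup>2"
      by (simp add: power_divide)
    finally have "1 - ((theta2 w / theta3 w)\<^sup>2)\<^sup>2 * (of_real (sin y))\<^sup>2 = of_real ((?D y / t\<^sup>2)\<^sup>2)"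
      unfolding th by (simp only: of_real_1 of_real_diff of_real_divide of_real_mult of_real_power flip: of_real_eq_iff[where 'a = complex])
    moreover have "csqrt (of_real ((?D y / t\<^sup>2)\<^sup>2)) = of_real (?D y / t\<^sup>2)"
    proof -
      have "?D y / t\<^sup>2 \<ge> 0" by simp
      then show ?thesis by (subst csqrt_of_real_nonneg) simp_all
    qed
    ultimately show ?thesis
      by (simp only: of_real_divide of_real_mult of_real_1) simp
  qed
  have "((\<lambda>y. t\<^sup>2 * (1 / ?D y)) has_integral t\<^sup>2 * gauss_integral (t\<^sup>2) (u\<^sup>2)) {0..pi/2}"
    unfolding gauss_integral_def using stu
    by (intro has_integral_mult_right integrable_integral integrable_continuous_interval gauss_integrand_continuous) auto
  then have "((\<lambda>y. complex_of_real (t\<^sup>2 * (1 / ?D y))) has_integral of_real (t\<^sup>2 * (pi / 2))) {0..pi/2}"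
    using gauss_integral_theta[OF x stu(2) th(2)[unfolded w] stu(3) th(3)[unfolded w]]
    by (intro has_integral_of_real) simp
  then have "ellK ((theta2 w / theta3 w)\<^sup>2) = of_real (t\<^sup>2 * (pi / 2))"
    unfolding ellK_def integrand by (rule integral_unique)
  then show ?thesis by (simp add: th)
qed

section \<open>The moduli and their continuation\<close>

text \<open>
  On the negative axis a logarithm of a positive function has imaginary part in \<open>2 pi Z\<close>, constant by
  continuity; subtracting it makes the logarithm real there.  The roots built from such a logarithm
  therefore agree with the principal ones on the real interval.
\<close>
lemma half_plane_holomorphic_log:
  assumes f: "f holomorphic_on {w. Re w < 0}" and nz: "\<And>w. Re w < 0 \<Longrightarrow> f w \<noteq> 0"
    and pos: "\<And>x. x < 0 \<Longrightarrow> \<exists>r>0. f (of_real x) = of_real (r :: real)"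
  obtains L where "L holomorphic_on {w. Re w < 0}" "\<And>w. Re w < 0 \<Longrightarrow> exp (L w) = f w"
    "\<And>x. x < 0 \<Longrightarrow> L (of_real x) \<in> \<real>"
proof -
  have "contractible {w. Re w < 0}"
    by (intro convex_imp_contractible convex_halfspace_Re_lt)
  then obtain g where g: "g holomorphic_on {w. Re w < 0}" "\<And>w. Re w < 0 \<Longrightarrow> f w = exp (g w)"
    using contractible_imp_holomorphic_log[OF f] nz by (metis mem_Collect_eq)
  define h where "h x = Im (g (of_real x))" for x
  have h_mult: "\<exists>n::int. h x = of_int (2 * n) * pi" if x: "x < 0" for x
  proof -
    obtain r where r: "r > 0" "f (of_real x) = of_real r" using pos[OF x] by blast
    then have "exp (g (of_real x)) = exp (of_real (ln r))"
      using g(2)[of "of_real x"] x by (simp add: exp_of_real)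
    then obtain n :: int where "g (of_real x) = of_real (ln r) + (of_int (2 * n) * pi) * \<i>"
      unfolding exp_eq by blast
    then have "h x = of_int (2 * n) * pi" by (simp add: h_def)
    then show ?thesis by blast
  qed
  have "h constant_on {..<0}"
  proof (rule continuous_discrete_range_constant)
    have "continuous_on {w. Re w < 0} g"
      by (rule holomorphic_on_imp_continuous_on[OF g(1)])
    then have "continuous_on {..<0} (\<lambda>x. g (of_real x))"
      by (rule continuous_on_compose2) (auto intro!: continuous_intros)
    then show "continuous_on {..<0} h"
      unfolding h_def by (intro continuous_intros)
    show "\<exists>e>0. \<forall>y. y \<in> {..<0} \<and> h y \<noteq> h x \<longrightarrow> e \<le> norm (h y - h x)" if x: "x \<in> {..<0}" for x
    proof (intro exI conjI allI impI)
      fix y assume y: "y \<in> {..<0} \<and> h y \<noteq> h x"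
      obtain m n :: int where mn: "h x = of_int (2 * m) * pi" "h y = of_int (2 * n) * pi"
        using h_mult[of x] h_mult[of y] x y by auto
      then have "n \<noteq> m" using y by auto
      then have "1 \<le> \<bar>real_of_int (n - m)\<bar>" by linarith
      then have "1 * (2 * pi) \<le> \<bar>real_of_int (n - m)\<bar> * (2 * pi)"
        by (intro mult_right_mono) auto
      also have "\<dots> = norm (h y - h x)"
      proof -
        have "h y - h x = real_of_int (n - m) * (2 * pi)" by (simp add: mn algebra_simps)
        then show ?thesis by (simp only: real_norm_def abs_mult) simp
      qed
      finally show "2 * pi \<le> norm (h y - h x)" by simp
    qed simp
  qed (auto simp: is_interval_connected is_interval_io)
  then obtain c where c: "\<And>x. x < 0 \<Longrightarrow> h x = c"
    by (auto simp: constant_on_def)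
  obtain n :: int where n: "c = of_int (2 * n) * pi"
    using h_mult[of "-1"] c[of "-1"] by auto
  show ?thesis
  proof
    show "(\<lambda>w. g w - of_real c * \<i>) holomorphic_on {w. Re w < 0}"
      by (intro holomorphic_intros g)
    have "exp (of_real c * \<i>) = 1"
      unfolding exp_eq_1 n by auto
    then show "exp (g w - of_real c * \<i>) = f w" if "Re w < 0" for w
      using g(2)[OF that] by (simp add: exp_diff)
    show "g (of_real x) - of_real c * \<i> \<in> \<real>" if "x < 0" for x
      using c[OF that] by (simp add: complex_is_Real_iff h_def)
  qed
qed

lemma has_sum_suminf_reindex:
  fixes f :: "int \<Rightarrow> complex"
  assumes "f summable_on A" "bij_betw g (UNIV :: nat set) A"
  shows "(f has_sum (\<Sum>m. f (g m))) A"
proof -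
  have "(f has_sum infsum f A) A"
    using assms(1) by (rule has_sum_infsum)
  then have "((\<lambda>m. f (g m)) has_sum infsum f A) UNIV"
    using has_sum_reindex_bij_betw[OF assms(2), of f] by simp
  then have "(\<Sum>m. f (g m)) = infsum f A"
    using has_sum_imp_sums sums_unique by metis
  then show ?thesis using \<open>(f has_sum infsum f A) A\<close> by simp
qed

text \<open>
  With \<open>n = a + m\<close> and \<open>n = a - 1 - m\<close>, \<open>m \<ge> 0\<close>, the integers are cut into two half-lines, each of
  which is the partial theta series of one continued fraction: \<open>n (n + 1)\<close> equals
  \<open>a (a + 1) + m (m + 1) + 2 a m\<close>, respectively \<open>a (a + 1) - 2 a + m (m + 1) - 2 a m\<close>.
\<close>
lemma theta_partial_sums:
  fixes a :: int
  assumes w: "Re w < 0"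
  shows "theta2 w = exp ((1/4) * (2 * of_int a + 1)\<^sup>2 * w) *
    ((\<Sum>m. exp w ^ (m * (m + 1)) * (exp w powi (2 * a)) ^ m) +
     exp w powi (- 2 * a) * (\<Sum>m. exp w ^ (m * (m + 1)) * (exp w powi (- 2 * a)) ^ m))"
proof -
  define q where "q = exp w"
  have S: "theta_term w w summable_on A" for A
    using summable_on_subset_banach[OF has_sum_imp_summable[OF theta_has_sum[OF w]]] by blast
  have pw: "q ^ k = exp (of_nat k * w)" "q powi i = exp (of_int i * w)" for k i
    by (simp_all add: q_def exp_of_nat_mult exp_power_int)
  have up: "(theta_term w w has_sum (\<Sum>m. theta_term w w (a + int m))) {a..}"
    by (rule has_sum_suminf_reindex[OF S bij_betwI[of _ _ _ "\<lambda>n. nat (n - a)"]]) auto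
  have dn: "(theta_term w w has_sum (\<Sum>m. theta_term w w (a - 1 - int m))) {..<a}"
    by (rule has_sum_suminf_reindex[OF S bij_betwI[of _ _ _ "\<lambda>n. nat (a - 1 - n)"]]) auto
  have "(theta_term w w has_sum (\<Sum>m. theta_term w w (a + int m)) + (\<Sum>m. theta_term w w (a - 1 - int m))) ({a..} \<union> {..<a})"
    by (rule has_sum_Un_disjoint[OF up dn]) auto
  moreover have "{a..} \<union> {..<a} = UNIV" by auto
  ultimately have th: "theta w w = (\<Sum>m. theta_term w w (a + int m)) + (\<Sum>m. theta_term w w (a - 1 - int m))"
    using has_sum_unique[OF theta_has_sum[OF w]] by simp
  have sm: "summable (\<lambda>m. q ^ (m * (m + 1)) * c ^ m)" for c
    by (rule summable_norm_cancel, simp only: norm_mult norm_power, rule summable_partial_theta) (use w in \<open>simp_all add: q_def\<close>)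
  define e where "e = exp (of_int (a * (a + 1)) * w)"
  have "theta_term w w (a + int m) = e * (q ^ (m * (m + 1)) * (q powi (2 * a)) ^ m)" for m
    unfolding pw theta_term_def e_def
    by (simp only: exp_of_nat_mult[symmetric] exp_add[symmetric])
      (rule arg_cong[where f = exp], simp add: power2_eq_square algebra_simps)
  then have 1: "(\<Sum>m. theta_term w w (a + int m)) = e * (\<Sum>m. q ^ (m * (m + 1)) * (q powi (2 * a)) ^ m)"
    by (simp only: suminf_mult[OF sm])
  have "theta_term w w (a - 1 - int m) = (e * q powi (- 2 * a)) * (q ^ (m * (m + 1)) * (q powi (- 2 * a)) ^ m)" for m
    unfolding pw theta_term_def e_def
    by (simp only: exp_of_nat_mult[symmetric] exp_add[symmetric])
      (rule arg_cong[where f = exp], simp add: power2_eq_square algebra_simps)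
  then have 2: "(\<Sum>m. theta_term w w (a - 1 - int m)) = (e * q powi (- 2 * a)) * (\<Sum>m. q ^ (m * (m + 1)) * (q powi (- 2 * a)) ^ m)"
    by (simp only: suminf_mult[OF sm])
  have "exp (w / 4) * e = exp ((1/4) * (2 * of_int a + 1)\<^sup>2 * w)"
    unfolding e_def exp_add[symmetric] by (rule arg_cong[where f = exp]) (simp add: power2_eq_square field_simps)
  then show ?thesis
    unfolding theta2_def th 1 2 q_def[symmetric] by (simp only: distrib_left mult.assoc[symmetric])
qed

text \<open>
  The moduli are theta quotients with nomes \<open>q\<close> and \<open>q^2\<close>, so their defining relations become
  polynomial consequences of the duplication formulas, the quartic identity and \<open>theta_phi_neg\<close>.
  The last equation is the sixth power of the quotient of roots in the theorem.
\<close>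
lemma moduli_identities:
  assumes w: "Re w < 0"
  defines "R \<equiv> (theta3 w ^ 4 + theta2 w ^ 4) / theta4 w ^ 4"
    and "k \<equiv> (theta2 w / theta3 w)\<^sup>2" and "k' \<equiv> (theta4 w / theta3 w)\<^sup>2"
    and "l \<equiv> (theta2 (2 * w) / theta3 (2 * w))\<^sup>2" and "l' \<equiv> (theta4 (2 * w) / theta3 (2 * w))\<^sup>2"
  shows "R\<^sup>2 = 1 + 64 * exp w * phi_neg (exp w) ^ 24" "1 + R \<noteq> 0"
    "k = 8 * exp (w / 2) * phi_neg (exp w) ^ 12 / (1 + R)" "k \<noteq> 0"
    "k'\<^sup>2 = 1 - k\<^sup>2" "l = (2 - k\<^sup>2 - 2 * k') / k\<^sup>2" "l'\<^sup>2 = 1 - l\<^sup>2"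
    "k * k' * l / l'\<^sup>2 = (theta2 w / theta3 w) ^ 6 / 4"
proof -
  have w2: "Re (2 * w) < 0" using w by simp
  define p t u P T U where "p = theta2 w" and "t = theta3 w" and "u = theta4 w"
    and "P = theta2 (2 * w)" and "T = theta3 (2 * w)" and "U = theta4 (2 * w)"
  note defs = p_def t_def u_def P_def T_def U_def
  have nz: "p \<noteq> 0" "t \<noteq> 0" "u \<noteq> 0" "P \<noteq> 0" "T \<noteq> 0" "U \<noteq> 0"
    unfolding defs using theta_const_nonzero[OF w] theta_const_nonzero[OF w2] by auto
  have quartic: "t ^ 4 = p ^ 4 + u ^ 4" "T ^ 4 = P ^ 4 + U ^ 4"
    unfolding defs using jacobi_quartic[OF w] jacobi_quartic[OF w2] by auto
  have double: "t\<^sup>2 = T\<^sup>2 + P\<^sup>2" "u\<^sup>2 = T\<^sup>2 - P\<^sup>2" "t * u = U\<^sup>2" "p\<^sup>2 = 2 * P * T"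
    unfolding defs using theta3_square[OF w] theta4_square[OF w] theta3_mult_theta4[OF w] theta2_square[OF w] by auto
  define f where "f = phi_neg (exp w)"
  define e where "e = exp (w / 4)"
  have e2: "exp (w / 2) = e\<^sup>2" and e1: "exp w = e ^ 4"
    unfolding e_def by (simp_all flip: exp_of_nat_mult)
  have phi: "p * t = 2 * e * f ^ 6 * u\<^sup>2"
    unfolding defs f_def e_def by (rule theta_phi_neg[OF w])
  have phi2: "8 * e\<^sup>2 * f ^ 12 * u ^ 4 = 2 * (p * t)\<^sup>2"
    unfolding phi by (simp add: power_mult_distrib flip: power_mult)
  have phi4: "64 * e ^ 4 * f ^ 24 * u ^ 8 = 4 * (p * t) ^ 4"
    unfolding phi by (simp add: power_mult_distrib flip: power_mult)
  have kR: "R = (t ^ 4 + p ^ 4) / u ^ 4" "k = (p / t)\<^sup>2" "k' = (u / t)\<^sup>2" "l = (P / T)\<^sup>2" "l' = (U / T)\<^sup>2"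
    unfolding R_def k_def k'_def l_def l'_def defs by simp_all
  have R1: "1 + R = 2 * t ^ 4 / u ^ 4"
    unfolding kR using nz by (simp add: quartic(1) field_simps)
  show "1 + R \<noteq> 0" unfolding R1 using nz by simp
  have "R\<^sup>2 = ((t ^ 4 + p ^ 4)\<^sup>2) / u ^ 8"
    unfolding kR by (simp add: power_divide flip: power_mult)
  also have "(t ^ 4 + p ^ 4)\<^sup>2 = (t ^ 4 - p ^ 4)\<^sup>2 + 4 * (p * t) ^ 4"
    by (simp add: power_mult_distrib power2_eq_square algebra_simps)
  also have "(t ^ 4 - p ^ 4)\<^sup>2 = u ^ 8"
    by (simp add: quartic(1) flip: power_mult)
  finally show "R\<^sup>2 = 1 + 64 * exp w * phi_neg (exp w) ^ 24"
    unfolding f_def[symmetric] unfolding phi4[symmetric] e1 using nz by (simp add: add_divide_distrib)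
  have "8 * e\<^sup>2 * f ^ 12 = 2 * (p * t)\<^sup>2 / u ^ 4"
    using phi2 nz by (simp add: field_simps)
  then have "8 * e\<^sup>2 * f ^ 12 / (1 + R) = (2 * (p * t)\<^sup>2 / u ^ 4) / (2 * t ^ 4 / u ^ 4)"
    unfolding R1 by simp
  also have "\<dots> = k"
    unfolding kR using nz by (simp add: field_simps power2_eq_square power4_eq_xxxx)
  finally show "k = 8 * exp (w / 2) * phi_neg (exp w) ^ 12 / (1 + R)"
    unfolding f_def e2 by simp
  show k0: "k \<noteq> 0" unfolding kR using nz by simp
  have k4: "k\<^sup>2 = p ^ 4 / t ^ 4" "k'\<^sup>2 = u ^ 4 / t ^ 4" "l\<^sup>2 = P ^ 4 / T ^ 4" "l'\<^sup>2 = U ^ 4 / T ^ 4"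
    unfolding kR by (simp_all add: power_divide flip: power_mult)
  have t4: "t ^ 4 \<noteq> 0" "T ^ 4 \<noteq> 0" using nz by auto
  show "k'\<^sup>2 = 1 - k\<^sup>2"
    unfolding k4 using t4(1) quartic(1) by (simp add: field_simps)
  show "l'\<^sup>2 = 1 - l\<^sup>2"
    unfolding k4 using t4(2) quartic(2) by (simp add: field_simps)
  have t24: "t ^ 4 = (t\<^sup>2)\<^sup>2" "p ^ 4 = (p\<^sup>2)\<^sup>2" by (simp_all flip: power_mult)
  have "2 - k\<^sup>2 - 2 * k' = (2 * (t\<^sup>2)\<^sup>2 - (p\<^sup>2)\<^sup>2 - 2 * u\<^sup>2 * t\<^sup>2) / t ^ 4"
    unfolding k4 kR using nz by (simp add: field_simps power2_eq_square power4_eq_xxxx)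
  also have "2 * (t\<^sup>2)\<^sup>2 - (p\<^sup>2)\<^sup>2 - 2 * u\<^sup>2 * t\<^sup>2 = 4 * P ^ 4"
    unfolding double by (simp add: power2_eq_square power4_eq_xxxx algebra_simps)
  finally have "(2 - k\<^sup>2 - 2 * k') / k\<^sup>2 = 4 * P ^ 4 / p ^ 4"
    unfolding k4 using nz by simp
  also have "\<dots> = l"
    unfolding kR t24 double using nz by (simp add: power2_eq_square power4_eq_xxxx field_simps)
  finally show "l = (2 - k\<^sup>2 - 2 * k') / k\<^sup>2" by simp
  have "U ^ 4 = (t * u)\<^sup>2" unfolding double by (simp flip: power_mult)
  then have "k * k' * l / l'\<^sup>2 = (p\<^sup>2 * (P * T)\<^sup>2) / t ^ 6"
    unfolding k4 kR using nz by (simp add: power_divide power_mult_distrib) (simp add: field_simps eval_nat_numeral)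
  also have "P * T = p\<^sup>2 / 2" using double(4) by simp
  finally show "k * k' * l / l'\<^sup>2 = (theta2 w / theta3 w) ^ 6 / 4"
    unfolding defs[symmetric] by (simp add: power_divide power_mult_distrib flip: power_mult power_add)
qed

lemma csqrt_square_pos: "r > 0 \<Longrightarrow> z = of_real r \<Longrightarrow> csqrt (z\<^sup>2) = z"
  by (rule csqrt_square) simp

text \<open>
  On the real interval all quotients are positive, which decides each principal square root.
\<close>
lemma moduli_real:
  fixes x :: real
  assumes x: "x < 0" and w: "w = of_real x"
  shows "csqrt (1 + 64 * exp w * phi_neg (exp w) ^ 24) = (theta3 w ^ 4 + theta2 w ^ 4) / theta4 w ^ 4"
    "k11 (exp w) = (theta2 w / theta3 w)\<^sup>2" "k12 (exp w) = (theta4 w / theta3 w)\<^sup>2"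
    "k21 (exp w) = (theta2 (2 * w) / theta3 (2 * w))\<^sup>2" "k22 (exp w) = (theta4 (2 * w) / theta3 (2 * w))\<^sup>2"
proof -
  have Re: "Re w < 0" using x w by simp
  note id = moduli_identities[OF Re]
  obtain s t u :: real where stu: "s > 0" "t > 0" "u > 0"
    and th: "theta2 w = of_real s" "theta3 w = of_real t" "theta4 w = of_real u"
    using theta_const_real_pos[OF x] unfolding w by metis
  have w2: "2 * w = of_real (2 * x)" using w by simp
  obtain T U :: real where TU: "T > 0" "U > 0"
    and th': "theta3 (2 * w) = of_real T" "theta4 (2 * w) = of_real U"
    using theta_const_real_pos[of "2 * x"] x unfolding w2 by (metis mult_pos_neg zero_less_numeral)
  show R: "csqrt (1 + 64 * exp w * phi_neg (exp w) ^ 24) = (theta3 w ^ 4 + theta2 w ^ 4) / theta4 w ^ 4"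
    unfolding id(1)[symmetric]
    by (rule csqrt_square_pos[of "(t ^ 4 + s ^ 4) / u ^ 4"]) (use stu in \<open>simp_all add: th add_pos_pos\<close>)
  have "csqrt (exp w) = csqrt ((exp (w / 2))\<^sup>2)"
    by (simp flip: exp_double)
  also have "\<dots> = exp (w / 2)"
    by (rule csqrt_square_pos[of "exp (x / 2)"]) (simp, metis w exp_of_real of_real_divide of_real_numeral)
  finally show k11: "k11 (exp w) = (theta2 w / theta3 w)\<^sup>2"
    unfolding k11_def R id(3) by simp
  show k12: "k12 (exp w) = (theta4 w / theta3 w)\<^sup>2"
    unfolding k12_def k11 id(5)[symmetric]
    by (rule csqrt_square_pos[of "(u / t)\<^sup>2"]) (use stu in \<open>simp_all add: th\<close>)
  show k21: "k21 (exp w) = (theta2 (2 * w) / theta3 (2 * w))\<^sup>2"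
    unfolding k21_def k11 k12 id(6) ..
  show "k22 (exp w) = (theta4 (2 * w) / theta3 (2 * w))\<^sup>2"
    unfolding k22_def k21 id(7)[symmetric]
    by (rule csqrt_square_pos[of "(U / T)\<^sup>2"]) (use TU in \<open>simp_all add: th'\<close>)
qed

lemma exp_powr_Reals:
  fixes z a :: complex
  assumes "z \<in> \<real>"
  shows "exp z powr a = exp (a * z)"
proof -
  have "Im z = 0" using assms by (simp add: complex_is_Real_iff)
  then have "Ln (exp z) = z" by (intro Ln_exp) auto
  then show ?thesis by (simp add: powr_def)
qed

lemma left_half_plane_eqI:
  assumes "f holomorphic_on {w. Re w < 0}" "g holomorphic_on {w. Re w < 0}"
    and eq: "\<And>x. x < 0 \<Longrightarrow> f (of_real x) = g (of_real x)" and w: "Re w < 0"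
  shows "f w = g w"
proof -
  have "f w - g w = 0"
  proof (rule analytic_continuation[where f = "\<lambda>w. f w - g w" and S = "{w. Re w < 0}" and U = "of_real ` {..<0}" and \<xi> = "-1"])
    show "(\<lambda>w. f w - g w) holomorphic_on {w. Re w < 0}"
      using assms by (intro holomorphic_intros)
    show "connected {w. Re w < 0}"
      by (intro convex_connected convex_halfspace_Re_lt)
    show "(-1 :: complex) islimpt of_real ` {..<0}"
      unfolding islimpt_approachable
    proof (intro allI impI)
      fix e :: real assume e: "e > 0"
      show "\<exists>z\<in>of_real ` {..<0}. z \<noteq> (-1 :: complex) \<and> dist z (-1) < e"
      proof (rule bexI[of _ "of_real (- 1 - e / 2)"])
        have "dist (of_real (- 1 - e / 2)) (- 1 :: complex) = norm (complex_of_real (- (e / 2)))"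
          by (simp add: dist_norm)
        then have "dist (of_real (- 1 - e / 2)) (- 1 :: complex) = e / 2"
          using e by (simp only: norm_of_real)
        then show "of_real (- 1 - e / 2) \<noteq> (-1 :: complex) \<and> dist (of_real (- 1 - e / 2)) (- 1 :: complex) < e"
          using e by (metis dist_self half_gt_zero less_irrefl field_sum_of_halves less_add_same_cancel1)
        show "complex_of_real (- 1 - e / 2) \<in> of_real ` {..<0}"
          using e by (intro imageI) simp
      qed
    qed
  qed (use eq w in \<open>auto intro: open_halfspace_Re_lt\<close>)
  then show ?thesis by simp
qed

text \<open>
  Square roots are continued by explicit theta quotients, the sixth and the cube root through
  holomorphic logarithms.  The final equation is checked for real \<open>w\<close>, where both sides are positive
  and have equal sixth powers, and then holds everywhere by the identity theorem.
\<close>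
lemma moduli_continuations:
  "\<exists>R K11 K12 K21 K22 P C E S.
       log_continuation R (\<lambda>q. csqrt (1 + 64 * q * phi_neg q ^ 24)) \<and>
       log_continuation K11 k11 \<and>
       log_continuation K12 k12 \<and>
       log_continuation K21 k21 \<and>
       log_continuation K22 k22 \<and>
       log_continuation P (\<lambda>q. (k11 q * k12 q * k21 q) powr (1/6)) \<and>
       log_continuation C (\<lambda>q. k22 q powr (1/3)) \<and>
       log_continuation E (\<lambda>q. ellK (k11 q)) \<and>
       log_continuation S (\<lambda>q. csqrt (ellK (k11 q) / of_real pi)) \<and>
       (\<forall>w. Re w < 0 \<longrightarrow>
          (R w)\<^sup>2 = 1 + 64 * exp w * phi_neg (exp w) ^ 24 \<and>
          1 + R w \<noteq> 0 \<and>
          K11 w = 8 * exp (w / 2) * phi_neg (exp w) ^ 12 / (1 + R w) \<and>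
          K11 w \<noteq> 0 \<and>
          (K12 w)\<^sup>2 = 1 - (K11 w)\<^sup>2 \<and>
          K21 w = (2 - (K11 w)\<^sup>2 - 2 * K12 w) / (K11 w)\<^sup>2 \<and>
          (K22 w)\<^sup>2 = 1 - (K21 w)\<^sup>2 \<and>
          P w ^ 6 = K11 w * K12 w * K21 w \<and>
          C w ^ 3 = K22 w \<and>
          C w \<noteq> 0 \<and>
          (S w)\<^sup>2 = E w / of_real pi) \<and>
       (\<forall>w. Re w < 0 \<longrightarrow> 2 powr (5/6) * (P w / C w) * S w = theta2 w)"
proof -
  define H where "H = {w :: complex. Re w < 0}"
  define R where "R w = (theta3 w ^ 4 + theta2 w ^ 4) / theta4 w ^ 4" for w
  define K11 where "K11 w = (theta2 w / theta3 w)\<^sup>2" for w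
  define K12 where "K12 w = (theta4 w / theta3 w)\<^sup>2" for w
  define K21 where "K21 w = (theta2 (2 * w) / theta3 (2 * w))\<^sup>2" for w
  define K22 where "K22 w = (theta4 (2 * w) / theta3 (2 * w))\<^sup>2" for w
  define E where "E w = of_real (pi / 2) * (theta3 w)\<^sup>2" for w
  define S where "S w = theta3 w / of_real (sqrt 2)" for w
  have nz: "theta2 w \<noteq> 0" "theta3 w \<noteq> 0" "theta4 w \<noteq> 0"
    "theta2 (2 * w) \<noteq> 0" "theta3 (2 * w) \<noteq> 0" "theta4 (2 * w) \<noteq> 0" if "Re w < 0" for w
    using theta_const_nonzero[of w] theta_const_nonzero[of "2 * w"] that by simp_all
  note hol = theta_const_holomorphic[folded H_def]
  have dbl: "(\<lambda>w. f (2 * w)) holomorphic_on H" if "f holomorphic_on H" for f :: "complex \<Rightarrow> complex"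
    by (rule holomorphic_on_compose_gen[OF _ that, unfolded o_def]) (auto simp: H_def intro!: holomorphic_intros)
  have hol_K: "R holomorphic_on H" "K11 holomorphic_on H" "K12 holomorphic_on H" "K21 holomorphic_on H"
      "K22 holomorphic_on H" "E holomorphic_on H" "S holomorphic_on H"
    unfolding R_def[abs_def] K11_def[abs_def] K12_def[abs_def] K21_def[abs_def] K22_def[abs_def] E_def[abs_def] S_def[abs_def]
    by (intro holomorphic_intros hol dbl; simp add: H_def nz)+
  have pos: "\<exists>s t u T U P. s > 0 \<and> t > 0 \<and> u > 0 \<and> P > 0 \<and> T > 0 \<and> U > 0 \<and>
      theta2 (of_real x) = of_real s \<and> theta3 (of_real x) = of_real t \<and> theta4 (of_real x) = of_real u \<and>
      theta2 (2 * of_real x) = of_real P \<and> theta3 (2 * of_real x) = of_real T \<and> theta4 (2 * of_real x) = of_real U"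
    if x: "x < 0" for x :: real
  proof -
    have "2 * x < 0" using x by simp
    then obtain P T U where 2: "P > 0" "T > 0" "U > 0" "theta2 (2 * of_real x) = of_real P"
        "theta3 (2 * of_real x) = of_real T" "theta4 (2 * of_real x) = of_real U"
      by (rule theta_const_real_pos) simp
    obtain s t u where "s > 0" "t > 0" "u > 0" "theta2 (of_real x) = of_real s"
        "theta3 (of_real x) = of_real t" "theta4 (of_real x) = of_real u"
      using x by (rule theta_const_real_pos)
    with 2 show ?thesis by blast
  qed
  have kprod_pos: "\<exists>r>0. K11 (of_real x) * K12 (of_real x) * K21 (of_real x) = of_real r" if x: "x < 0" for x
  proof -
    obtain s t u T P where st: "s > 0" "t > 0" "u > 0" "P > 0" "T > 0"
      "theta2 (of_real x) = of_real s" "theta3 (of_real x) = of_real t" "theta4 (of_real x) = of_real u"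
      "theta2 (2 * of_real x) = of_real P" "theta3 (2 * of_real x) = of_real T"
      using pos[OF x] by blast
    show ?thesis
      using st(1-5)
      by (intro exI[of _ "(s / t)\<^sup>2 * (u / t)\<^sup>2 * (P / T)\<^sup>2"] conjI mult_pos_pos zero_less_power divide_pos_pos)
        (simp_all add: K11_def K12_def K21_def st(6-))
  qed
  have k22_pos: "\<exists>r>0. K22 (of_real x) = of_real r" if x: "x < 0" for x
  proof -
    obtain T U where st: "T > 0" "U > 0" "theta3 (2 * of_real x) = of_real T" "theta4 (2 * of_real x) = of_real U"
      using pos[OF x] by blast
    show ?thesis
      using st(1,2)
      by (intro exI[of _ "(U / T)\<^sup>2"] conjI zero_less_power divide_pos_pos) (simp_all add: K22_def st(3-))
  qed
  obtain LP where LP: "LP holomorphic_on H" "\<And>w. Re w < 0 \<Longrightarrow> exp (LP w) = K11 w * K12 w * K21 w"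
      "\<And>x. x < 0 \<Longrightarrow> LP (of_real x) \<in> \<real>"
  proof (rule half_plane_holomorphic_log[of "\<lambda>w. K11 w * K12 w * K21 w"])
    show "(\<lambda>w. K11 w * K12 w * K21 w) holomorphic_on {w. Re w < 0}"
      using hol_K by (intro holomorphic_intros) (simp_all add: H_def)
    show "K11 w * K12 w * K21 w \<noteq> 0" if "Re w < 0" for w
      using nz[OF that] by (simp add: K11_def K12_def K21_def)
  qed (use kprod_pos in \<open>auto simp: H_def\<close>)
  obtain LC where LC: "LC holomorphic_on H" "\<And>w. Re w < 0 \<Longrightarrow> exp (LC w) = K22 w"
      "\<And>x. x < 0 \<Longrightarrow> LC (of_real x) \<in> \<real>"
  proof (rule half_plane_holomorphic_log[of K22])
    show "K22 holomorphic_on {w. Re w < 0}"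
      using hol_K by (simp add: H_def)
    show "K22 w \<noteq> 0" if "Re w < 0" for w
      using nz[OF that] by (simp add: K22_def)
  qed (use k22_pos in \<open>auto simp: H_def\<close>)
  define P where "P w = exp (1 / 6 * LP w)" for w
  define C where "C w = exp (1 / 3 * LC w)" for w
  have P6: "P w ^ 6 = K11 w * K12 w * K21 w" and C3: "C w ^ 3 = K22 w" if "Re w < 0" for w
    using LP(2)[OF that] LC(2)[OF that] by (simp_all add: P_def C_def flip: exp_of_nat_mult)
  have hol_PC: "P holomorphic_on H" "C holomorphic_on H"
    unfolding P_def[abs_def] C_def[abs_def] by (intro holomorphic_intros LP LC)+
  have C_nz: "C w \<noteq> 0" for w
    by (simp add: C_def)
  have S2: "(S w)\<^sup>2 = E w / of_real pi" for w
    by (simp add: S_def E_def power_divide flip: of_real_power)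
  have cont: "log_continuation F f \<longleftrightarrow> F holomorphic_on H \<and> (\<forall>x<0. F (of_real x) = f (exp (of_real x)))" for F f
    by (simp add: log_continuation_def H_def)
  have real_P: "P (of_real x) = (k11 q * k12 q * k21 q) powr (1/6)"
    and real_C: "C (of_real x) = k22 q powr (1/3)"
    and real_E: "E (of_real x) = ellK (k11 q)"
    and real_S: "S (of_real x) = csqrt (ellK (k11 q) / of_real pi)"
    if x: "x < 0" and q: "q = exp (of_real x)" for x q
  proof -
    note real = moduli_real[OF x refl, folded K11_def K12_def K21_def K22_def q]
    have Re: "Re (of_real x) < 0" using x by simp
    show "P (of_real x) = (k11 q * k12 q * k21 q) powr (1/6)"
      unfolding real LP(2)[OF Re, symmetric] exp_powr_Reals[OF LP(3)[OF x]] P_def ..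
    show "C (of_real x) = k22 q powr (1/3)"
      unfolding real LC(2)[OF Re, symmetric] exp_powr_Reals[OF LC(3)[OF x]] C_def ..
    show E: "E (of_real x) = ellK (k11 q)"
      unfolding real K11_def E_def by (rule ellK_theta[OF x refl, symmetric])
    obtain t where t: "t > 0" "theta3 (of_real x) = of_real t"
      using pos[OF x] by blast
    show "S (of_real x) = csqrt (ellK (k11 q) / of_real pi)"
      unfolding E[symmetric] S2[symmetric]
      by (rule csqrt_square_pos[symmetric, of "t / sqrt 2"]) (use t in \<open>simp_all add: S_def\<close>)
  qed
  have G_real: "2 powr (5/6) * (P (of_real x) / C (of_real x)) * S (of_real x) = theta2 (of_real x)" if x: "x < 0" for x
  proof -
    have Re: "Re (of_real x) < 0" using x by simp
    obtain s t where st: "s > 0" "t > 0" "theta2 (of_real x) = of_real s" "theta3 (of_real x) = of_real t"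
      using pos[OF x] by blast
    obtain p c where pc: "LP (of_real x) = of_real p" "LC (of_real x) = of_real c"
      using LP(3)[OF x] LC(3)[OF x] by (auto simp: Reals_def)
    define g where "g = 2 powr (5/6) * (exp (1/6 * p) / exp (1/3 * c)) * (t / sqrt 2)"
    have "(2 :: complex) powr (5/6) = of_real (2 powr (5/6))"
      using powr_of_real[of 2 "5/6"] by simp
    moreover have "P (of_real x) = of_real (exp (1/6 * p))" "C (of_real x) = of_real (exp (1/3 * c))"
      by (simp_all add: P_def C_def pc flip: exp_of_real)
    ultimately have G: "2 powr (5/6) * (P (of_real x) / C (of_real x)) * S (of_real x) = of_real g"
      by (simp add: g_def S_def st)
    have c6: "((2 :: complex) powr (5/6)) ^ 6 = 32"
    proof -
      have "((2 :: complex) powr (5/6)) ^ 6 = exp (of_nat 6 * (5/6 * Ln 2))"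
        unfolding exp_of_nat_mult by (simp add: powr_def)
      also have "\<dots> = exp (of_nat 5 * Ln 2)" by simp
      also have "\<dots> = 2 ^ 5" unfolding exp_of_nat_mult by simp
      finally show ?thesis by simp
    qed
    have "sqrt 2 ^ 6 = ((sqrt 2)\<^sup>2) ^ 3" by (simp only: flip: power_mult) simp
    then have S6: "S (of_real x) ^ 6 = theta3 (of_real x) ^ 6 / 8"
      by (simp add: S_def power_divide flip: of_real_power)
    have PC6: "(P (of_real x) / C (of_real x)) ^ 6 = (theta2 (of_real x) / theta3 (of_real x)) ^ 6 / 4"
    proof -
      have "C (of_real x) ^ 6 = (C (of_real x) ^ 3)\<^sup>2" by (simp flip: power_mult)
      then show ?thesis
        unfolding power_divide[of "P _"] P6[OF Re] C3[OF Re]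
        using moduli_identities(8)[OF Re] by (simp add: K11_def K12_def K21_def K22_def)
    qed
    have "(2 powr (5/6) * (P (of_real x) / C (of_real x)) * S (of_real x)) ^ 6 = theta2 (of_real x) ^ 6"
      unfolding power_mult_distrib c6 S6 PC6 unfolding power_divide using nz(2)[OF Re] by simp
    then have "complex_of_real (g ^ 6) = of_real (s ^ 6)"
      unfolding G st by simp
    then have "g ^ 6 = s ^ 6" unfolding of_real_eq_iff .
    moreover have "g > 0" using st by (simp add: g_def)
    ultimately have "g = s" using st(1) by (intro power_eq_imp_eq_base[of g 6 s]) auto
    then show ?thesis unfolding G st by simp
  qed
  have G: "2 powr (5/6) * (P w / C w) * S w = theta2 w" if "Re w < 0" for w
  proof (rule left_half_plane_eqI[where f = "\<lambda>w. 2 powr (5/6) * (P w / C w) * S w" and g = theta2, OF _ _ G_real that])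
    show "(\<lambda>w. 2 powr (5/6) * (P w / C w) * S w) holomorphic_on {w. Re w < 0}"
      using hol_PC hol_K unfolding H_def by (intro holomorphic_intros) (simp_all add: C_nz)
  qed (use hol in \<open>simp_all add: H_def\<close>)
  show ?thesis
  proof (rule exI[of _ R], rule exI[of _ K11], rule exI[of _ K12], rule exI[of _ K21], rule exI[of _ K22],
      rule exI[of _ P], rule exI[of _ C], rule exI[of _ E], rule exI[of _ S], intro conjI allI impI)
    show "log_continuation R (\<lambda>q. csqrt (1 + 64 * q * phi_neg q ^ 24))"
      unfolding cont R_def using hol_K(1) moduli_real(1)[OF _ refl] by (simp add: R_def[abs_def])
    show "log_continuation K11 k11" "log_continuation K12 k12" "log_continuation K21 k21" "log_continuation K22 k22"
      unfolding cont using hol_K moduli_real(2-5)[OF _ refl] by (simp_all add: K11_def K12_def K21_def K22_def)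
    show "log_continuation P (\<lambda>q. (k11 q * k12 q * k21 q) powr (1/6))" "log_continuation C (\<lambda>q. k22 q powr (1/3))"
      "log_continuation E (\<lambda>q. ellK (k11 q))" "log_continuation S (\<lambda>q. csqrt (ellK (k11 q) / of_real pi))"
      unfolding cont using hol_K hol_PC real_P real_C real_E real_S by simp_all
    fix w :: complex assume w: "Re w < 0"
    note id = moduli_identities[OF w, folded K11_def K12_def K21_def K22_def, folded R_def]
    show "(R w)\<^sup>2 = 1 + 64 * exp w * phi_neg (exp w) ^ 24" by (rule id)
    show "1 + R w \<noteq> 0" by (rule id)
    show "K11 w = 8 * exp (w / 2) * phi_neg (exp w) ^ 12 / (1 + R w)" by (rule id)
    show "K11 w \<noteq> 0" by (rule id)
    show "(K12 w)\<^sup>2 = 1 - (K11 w)\<^sup>2" by (rule id)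
    show "K21 w = (2 - (K11 w)\<^sup>2 - 2 * K12 w) / (K11 w)\<^sup>2" by (rule id)
    show "(K22 w)\<^sup>2 = 1 - (K21 w)\<^sup>2" by (rule id)
    show "P w ^ 6 = K11 w * K12 w * K21 w" by (rule P6[OF w])
    show "C w ^ 3 = K22 w" by (rule C3[OF w])
    show "C w \<noteq> 0" by (rule C_nz)
    show "(S w)\<^sup>2 = E w / of_real pi" by (rule S2)
    show "2 powr (5/6) * (P w / C w) * S w = theta2 w" by (rule G[OF w])
  qed
qed

theorem mainTheorem2:
  fixes a :: int and q :: complex
  assumes "q \<noteq> 0" and "norm q < 1"
  shows "\<exists>x y.
    M_has_value (q powi (2 * a)) (q\<^sup>2) x \<and>
    M_has_value (q powi (- 2 * a)) (q\<^sup>2) y \<and>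
    (q \<in> \<real> \<and> Re q > 0 \<longrightarrow>
       x + q powi (- 2 * a) * y =
         2 powr (5/6) * q powr (- (1/4) * (2 * of_int a + 1)\<^sup>2)
         * ((k11 q * k12 q * k21 q) powr (1/6) / k22 q powr (1/3))
         * csqrt (ellK (k11 q) / of_real pi)) \<and>
    (\<exists>R K11 K12 K21 K22 P C E S.
       log_continuation R (\<lambda>q. csqrt (1 + 64 * q * phi_neg q ^ 24)) \<and>
       log_continuation K11 k11 \<and>
       log_continuation K12 k12 \<and>
       log_continuation K21 k21 \<and>
       log_continuation K22 k22 \<and>
       log_continuation P (\<lambda>q. (k11 q * k12 q * k21 q) powr (1/6)) \<and>
       log_continuation C (\<lambda>q. k22 q powr (1/3)) \<and>
       log_continuation E (\<lambda>q. ellK (k11 q)) \<and>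
       log_continuation S (\<lambda>q. csqrt (ellK (k11 q) / of_real pi)) \<and>
       (\<forall>w. Re w < 0 \<longrightarrow>
          (R w)\<^sup>2 = 1 + 64 * exp w * phi_neg (exp w) ^ 24 \<and>
          1 + R w \<noteq> 0 \<and>
          K11 w = 8 * exp (w / 2) * phi_neg (exp w) ^ 12 / (1 + R w) \<and>
          K11 w \<noteq> 0 \<and>
          (K12 w)\<^sup>2 = 1 - (K11 w)\<^sup>2 \<and>
          K21 w = (2 - (K11 w)\<^sup>2 - 2 * K12 w) / (K11 w)\<^sup>2 \<and>
          (K22 w)\<^sup>2 = 1 - (K21 w)\<^sup>2 \<and>
          P w ^ 6 = K11 w * K12 w * K21 w \<and>
          C w ^ 3 = K22 w \<and>
          C w \<noteq> 0 \<and>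
          (S w)\<^sup>2 = E w / of_real pi) \<and>
       (\<forall>w. exp w = q \<longrightarrow>
          x + q powi (- 2 * a) * y =
            2 powr (5/6) * exp (- (1/4) * (2 * of_int a + 1)\<^sup>2 * w)
            * (P w / C w) * S w))"
proof -
  define x where "x = (\<Sum>m. q ^ (m * (m + 1)) * (q powi (2 * a)) ^ m)"
  define y where "y = (\<Sum>m. q ^ (m * (m + 1)) * (q powi (- 2 * a)) ^ m)"
  define c :: complex where "c = (1/4) * (2 * of_int a + 1)\<^sup>2"
  obtain R K11 K12 K21 K22 P C E S where cont:
    "log_continuation R (\<lambda>q. csqrt (1 + 64 * q * phi_neg q ^ 24)) \<and>
       log_continuation K11 k11 \<and>
       log_continuation K12 k12 \<and>
       log_continuation K21 k21 \<and>
       log_continuation K22 k22 \<and>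
       log_continuation P (\<lambda>q. (k11 q * k12 q * k21 q) powr (1/6)) \<and>
       log_continuation C (\<lambda>q. k22 q powr (1/3)) \<and>
       log_continuation E (\<lambda>q. ellK (k11 q)) \<and>
       log_continuation S (\<lambda>q. csqrt (ellK (k11 q) / of_real pi)) \<and>
       (\<forall>w. Re w < 0 \<longrightarrow>
          (R w)\<^sup>2 = 1 + 64 * exp w * phi_neg (exp w) ^ 24 \<and>
          1 + R w \<noteq> 0 \<and>
          K11 w = 8 * exp (w / 2) * phi_neg (exp w) ^ 12 / (1 + R w) \<and>
          K11 w \<noteq> 0 \<and>
          (K12 w)\<^sup>2 = 1 - (K11 w)\<^sup>2 \<and>
          K21 w = (2 - (K11 w)\<^sup>2 - 2 * K12 w) / (K11 w)\<^sup>2 \<and>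
          (K22 w)\<^sup>2 = 1 - (K21 w)\<^sup>2 \<and>
          P w ^ 6 = K11 w * K12 w * K21 w \<and>
          C w ^ 3 = K22 w \<and>
          C w \<noteq> 0 \<and>
          (S w)\<^sup>2 = E w / of_real pi)"
    and theta: "\<forall>w. Re w < 0 \<longrightarrow> 2 powr (5/6) * (P w / C w) * S w = theta2 w"
    using moduli_continuations by (elim exE conjE) (rule that, intro conjI; assumption)
  have sum: "x + q powi (- 2 * a) * y =
      2 powr (5/6) * exp (- (1/4) * (2 * of_int a + 1)\<^sup>2 * w) * (P w / C w) * S w" if w: "exp w = q" for w
  proof -
    have Re: "Re w < 0" using assms(2) w by auto
    have "theta2 w = exp (c * w) * (x + q powi (- 2 * a) * y)"
      using theta_partial_sums[OF Re, of a] by (simp only: w x_def y_def c_def)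
    then have "x + q powi (- 2 * a) * y = exp (- c * w) * theta2 w"
      by (simp add: exp_minus)
    also have "- c * w = - (1/4) * (2 * of_int a + 1)\<^sup>2 * w"
      by (simp add: c_def)
    also have "theta2 w = 2 powr (5/6) * (P w / C w) * S w"
      using theta Re by simp
    finally show ?thesis by (simp only: mult_ac)
  qed
  have real: "x + q powi (- 2 * a) * y =
         2 powr (5/6) * q powr (- (1/4) * (2 * of_int a + 1)\<^sup>2)
         * ((k11 q * k12 q * k21 q) powr (1/6) / k22 q powr (1/3))
         * csqrt (ellK (k11 q) / of_real pi)" if "q \<in> \<real>" "Re q > 0"
  proof -
    define r where "r = ln (Re q)"
    have q: "q = exp (of_real r)"
      using that by (simp add: r_def exp_of_real)
    have r: "r < 0" using assms(2) q by simp
    have "q powr (- (1/4) * (2 * of_int a + 1)\<^sup>2) = exp (- (1/4) * (2 * of_int a + 1)\<^sup>2 * of_real r)"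
      unfolding q by (rule exp_powr_Reals) simp
    moreover have "P (of_real r) = (k11 q * k12 q * k21 q) powr (1/6)" "C (of_real r) = k22 q powr (1/3)"
      "S (of_real r) = csqrt (ellK (k11 q) / of_real pi)"
      using cont r unfolding log_continuation_def q by blast+
    ultimately show ?thesis
      using sum[OF q[symmetric]] by simp
  qed
  show ?thesis
  proof (rule exI[of _ x], rule exI[of _ y], intro conjI)
    show "M_has_value (q powi (2 * a)) (q\<^sup>2) x" "M_has_value (q powi (- 2 * a)) (q\<^sup>2) y"
      unfolding x_def y_def by (rule M_has_value_partial_theta[OF assms(2)])+
    show "q \<in> \<real> \<and> Re q > 0 \<longrightarrow>
       x + q powi (- 2 * a) * y =
         2 powr (5/6) * q powr (- (1/4) * (2 * of_int a + 1)\<^sup>2)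
         * ((k11 q * k12 q * k21 q) powr (1/6) / k22 q powr (1/3))
         * csqrt (ellK (k11 q) / of_real pi)"
      using real by blast
    from cont have cont': "log_continuation R (\<lambda>q. csqrt (1 + 64 * q * phi_neg q ^ 24)) \<and>
       log_continuation K11 k11 \<and>
       log_continuation K12 k12 \<and>
       log_continuation K21 k21 \<and>
       log_continuation K22 k22 \<and>
       log_continuation P (\<lambda>q. (k11 q * k12 q * k21 q) powr (1/6)) \<and>
       log_continuation C (\<lambda>q. k22 q powr (1/3)) \<and>
       log_continuation E (\<lambda>q. ellK (k11 q)) \<and>
       log_continuation S (\<lambda>q. csqrt (ellK (k11 q) / of_real pi)) \<and>
       (\<forall>w. Re w < 0 \<longrightarrow>
          (R w)\<^sup>2 = 1 + 64 * exp w * phi_neg (exp w) ^ 24 \<and>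
          1 + R w \<noteq> 0 \<and>
          K11 w = 8 * exp (w / 2) * phi_neg (exp w) ^ 12 / (1 + R w) \<and>
          K11 w \<noteq> 0 \<and>
          (K12 w)\<^sup>2 = 1 - (K11 w)\<^sup>2 \<and>
          K21 w = (2 - (K11 w)\<^sup>2 - 2 * K12 w) / (K11 w)\<^sup>2 \<and>
          (K22 w)\<^sup>2 = 1 - (K21 w)\<^sup>2 \<and>
          P w ^ 6 = K11 w * K12 w * K21 w \<and>
          C w ^ 3 = K22 w \<and>
          C w \<noteq> 0 \<and>
          (S w)\<^sup>2 = E w / of_real pi) \<and>
       (\<forall>w. exp w = q \<longrightarrow>
          x + q powi (- 2 * a) * y =
            2 powr (5/6) * exp (- (1/4) * (2 * of_int a + 1)\<^sup>2 * w)
            * (P w / C w) * S w)"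
      using sum by blast
    show "\<exists>R K11 K12 K21 K22 P C E S.
       log_continuation R (\<lambda>q. csqrt (1 + 64 * q * phi_neg q ^ 24)) \<and>
       log_continuation K11 k11 \<and>
       log_continuation K12 k12 \<and>
       log_continuation K21 k21 \<and>
       log_continuation K22 k22 \<and>
       log_continuation P (\<lambda>q. (k11 q * k12 q * k21 q) powr (1/6)) \<and>
       log_continuation C (\<lambda>q. k22 q powr (1/3)) \<and>
       log_continuation E (\<lambda>q. ellK (k11 q)) \<and>
       log_continuation S (\<lambda>q. csqrt (ellK (k11 q) / of_real pi)) \<and>
       (\<forall>w. Re w < 0 \<longrightarrow>
          (R w)\<^sup>2 = 1 + 64 * exp w * phi_neg (exp w) ^ 24 \<and>
          1 + R w \<noteq> 0 \<and>
          K11 w = 8 * exp (w / 2) * phi_neg (exp w) ^ 12 / (1 + R w) \<and>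
          K11 w \<noteq> 0 \<and>
          (K12 w)\<^sup>2 = 1 - (K11 w)\<^sup>2 \<and>
          K21 w = (2 - (K11 w)\<^sup>2 - 2 * K12 w) / (K11 w)\<^sup>2 \<and>
          (K22 w)\<^sup>2 = 1 - (K21 w)\<^sup>2 \<and>
          P w ^ 6 = K11 w * K12 w * K21 w \<and>
          C w ^ 3 = K22 w \<and>
          C w \<noteq> 0 \<and>
          (S w)\<^sup>2 = E w / of_real pi) \<and>
       (\<forall>w. exp w = q \<longrightarrow>
          x + q powi (- 2 * a) * y =
            2 powr (5/6) * exp (- (1/4) * (2 * of_int a + 1)\<^sup>2 * w)
            * (P w / C w) * S w)"
      using cont' by (intro exI)
  qed
qed

end
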